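(* Let $L^\bullet_{\mathrm{cl}}$ be a classical generalized operator algebra and $\mathfrak A$ a complex $\cdots\to H(g^j)\xrightarrow{A_j}H(g^{j+1})\to\cdots$ with $A_j\in L^0_{\mathrm{cl}}((g^j,g^{j+1}))$, $j\in\mathbb Z$. The following are equivalent: (a) $\mathfrak A$ is elliptic; (b) all Laplacians $\Delta_j=A_{j-1}A_{j-1}^*+A_j^*A_j$, $j\in\mathbb Z$, are elliptic. These properties imply (c) $\mathfrak A$ has a parametrix in $L^\bullet_{\mathrm{cl}}$ (operators $B_j\in L^0_{\mathrm{cl}}((g^{j+1},g^j))$ with $A_{j-1}B_{j-1}+B_jA_j-1$ smoothing for all $j$) and (d) $\mathfrak A$ is a Fredholm complex. If $L^\bullet_{\mathrm{cl}}$ has the Fredholm property, (a)–(d) are all equivalent; if it has the extended Fredholm property, the parametrix in (c) can be chosen to be a complex ($B_jB_{j+1}=0$).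
   Context: Generalized operator algebra $L^\bullet$: a set $G$ of weights; to each $g\in G$ a Hilbert space $H(g)$; for each pair $(g^0,g^1)$ vector spaces $L^{-\infty}\subset L^0\subset\mathcal L(H(g^0),H(g^1))$ with compact smoothing operators, identities in $L^0((g,g))$, closed under composition (orders adding in $\{0,-\infty\}$) and Hilbert adjoints. Classical: there is a principal symbol map $A\mapsto\sigma(A)=(\sigma_1(A),\dots,\sigma_n(A))$ assigning to $A\in L^0_{\mathrm{cl}}((g^0,g^1))$ Hilbert bundle morphisms $\sigma_\ell(A):E_\ell(g^0)\to E_\ell(g^1)$ (for fixed $\ell$ all bundles $E_\ell(g)$ have the same base) which is linear, multiplicative under composition, satisfies $\sigma_\ell(A^* )=\sigma_\ell(A)^*$ (fibrewise adjoint), vanishes on smoothing operators, and such that $A$ is elliptic (all $\sigma_\ell(A)$ isomorphisms) iff $A$ has a parametrix in $L^0_{\mathrm{cl}}$ (inverse modulo smoothing operators). A complex $\mathfrak A$ is elliptic if for each $\ell$ the family of complexes $\cdots\to E_\ell(g^j)\xrightarrow{\sigma_\ell(A_j)}E_\ell(g^{j+1})\to\cdots$ is exact in every fibre. Fredholm property: every $A\in L^0$ has a parametrix iff it is Fredholm. Extended Fredholm property: Fredholm property plus: every selfadjoint Fredholm $A\in L^0((g,g))$ has a parametrix $B$ with $AB=BA=1-\pi$, $\pi$ the orthogonal projection onto $\ker A$. A Fredholm complex has finite-dimensional cohomology. *)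

theory Defs
  imports "HOL-Analysis.Analysis"
begin

text \<open>
Modelling conventions.
All Hilbert spaces H(g) are closed linear subspaces of one ambient real Hilbert space
of type 'h.  An operator from H(g0) to H(g1) is represented by a function 'h => 'h that
is linear and bounded on H(g0), maps H(g0) into H(g1) and is 0 outside H(g0)
(this normalisation makes operators extensional, and composition, sums and
the identity are the obvious ones).  Fibres of the Hilbert bundles E_l(g) over the
base X l are closed subspaces of one ambient real Hilbert space 'e, and bundle
morphisms are represented fibrewise in the same normalised way.
\<close>

definition hilbert_sub :: "'a::real_inner set \<Rightarrow> bool" where
  "hilbert_sub S \<longleftrightarrow> subspace S \<and> closed S"

definition bop :: "'a::real_normed_vector set \<Rightarrow> 'a set \<Rightarrow> ('a \<Rightarrow> 'a) \<Rightarrow> bool" where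
  "bop S T f \<longleftrightarrow>
     (\<forall>x\<in>S. \<forall>y\<in>S. f (x + y) = f x + f y) \<and>
     (\<forall>c. \<forall>x\<in>S. f (c *\<^sub>R x) = c *\<^sub>R f x) \<and>
     (\<exists>K. \<forall>x\<in>S. norm (f x) \<le> K * norm x) \<and>
     f ` S \<subseteq> T \<and>
     (\<forall>x. x \<notin> S \<longrightarrow> f x = 0)"

definition idop :: "'a::real_vector set \<Rightarrow> 'a \<Rightarrow> 'a" where
  "idop S = (\<lambda>x. if x \<in> S then x else 0)"

definition is_adj :: "'a::real_inner set \<Rightarrow> 'a set \<Rightarrow> ('a \<Rightarrow> 'a) \<Rightarrow> ('a \<Rightarrow> 'a) \<Rightarrow> bool" where
  "is_adj S T f f' \<longleftrightarrow> (\<forall>x\<in>S. \<forall>y\<in>T. inner (f x) y = inner x (f' y))"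

definition compact_op :: "'a::real_normed_vector set \<Rightarrow> ('a \<Rightarrow> 'a) \<Rightarrow> bool" where
  "compact_op S f \<longleftrightarrow> compact (closure (f ` (S \<inter> cball 0 1)))"

definition is_orth_proj :: "'a::real_inner set \<Rightarrow> 'a set \<Rightarrow> ('a \<Rightarrow> 'a) \<Rightarrow> bool" where
  "is_orth_proj S K P \<longleftrightarrow> (\<forall>x. x \<notin> S \<longrightarrow> P x = 0) \<and>
     (\<forall>x\<in>S. P x \<in> K \<and> (\<forall>k\<in>K. inner (x - P x) k = 0))"

definition fredholm_op :: "'a::real_normed_vector set \<Rightarrow> 'a set \<Rightarrow> ('a \<Rightarrow> 'a) \<Rightarrow> bool" where
  "fredholm_op S T f \<longleftrightarrow>
     (\<exists>F. finite F \<and> {x\<in>S. f x = 0} \<subseteq> span F) \<and>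
     closed (f ` S) \<and>
     (\<exists>F. finite F \<and> T \<subseteq> span (F \<union> f ` S))"

definition adjop ::
  "('g \<Rightarrow> 'h::real_inner set) \<Rightarrow> ('g \<Rightarrow> 'g \<Rightarrow> ('h \<Rightarrow> 'h) set) \<Rightarrow> 'g \<Rightarrow> 'g \<Rightarrow> ('h \<Rightarrow> 'h) \<Rightarrow> ('h \<Rightarrow> 'h)" where
  "adjop H L g0 g1 A = (SOME A'. A' \<in> L g1 g0 \<and> is_adj (H g0) (H g1) A A')"

definition has_parametrix ::
  "('g \<Rightarrow> 'h::real_inner set) \<Rightarrow> ('g \<Rightarrow> 'g \<Rightarrow> ('h \<Rightarrow> 'h) set) \<Rightarrow> ('g \<Rightarrow> 'g \<Rightarrow> ('h \<Rightarrow> 'h) set)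
   \<Rightarrow> 'g \<Rightarrow> 'g \<Rightarrow> ('h \<Rightarrow> 'h) \<Rightarrow> bool" where
  "has_parametrix H L0 Linf g0 g1 A \<longleftrightarrow>
     (\<exists>B\<in>L0 g1 g0. (\<lambda>y. A (B y) - idop (H g1) y) \<in> Linf g1 g1 \<and>
                   (\<lambda>y. B (A y) - idop (H g0) y) \<in> Linf g0 g0)"

definition gen_op_alg ::
  "('g \<Rightarrow> 'h::{real_inner,complete_space} set) \<Rightarrow> ('g \<Rightarrow> 'g \<Rightarrow> ('h \<Rightarrow> 'h) set)
   \<Rightarrow> ('g \<Rightarrow> 'g \<Rightarrow> ('h \<Rightarrow> 'h) set) \<Rightarrow> bool" where
  "gen_op_alg H L0 Linf \<longleftrightarrow>
     (\<forall>g. hilbert_sub (H g)) \<and>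
     (\<forall>g0 g1. Linf g0 g1 \<subseteq> L0 g0 g1 \<and> L0 g0 g1 \<subseteq> {A. bop (H g0) (H g1) A}) \<and>
     (\<forall>g0 g1. (\<lambda>_. 0) \<in> Linf g0 g1) \<and>
     (\<forall>g0 g1. \<forall>A\<in>L0 g0 g1. \<forall>B\<in>L0 g0 g1. (\<lambda>y. A y + B y) \<in> L0 g0 g1) \<and>
     (\<forall>g0 g1. \<forall>A\<in>Linf g0 g1. \<forall>B\<in>Linf g0 g1. (\<lambda>y. A y + B y) \<in> Linf g0 g1) \<and>
     (\<forall>g0 g1 c. \<forall>A\<in>L0 g0 g1. (\<lambda>y. c *\<^sub>R A y) \<in> L0 g0 g1) \<and>
     (\<forall>g0 g1 c. \<forall>A\<in>Linf g0 g1. (\<lambda>y. c *\<^sub>R A y) \<in> Linf g0 g1) \<and>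
     (\<forall>g0 g1. \<forall>A\<in>Linf g0 g1. compact_op (H g0) A) \<and>
     (\<forall>g. idop (H g) \<in> L0 g g) \<and>
     (\<forall>g0 g1 g2. \<forall>A\<in>L0 g0 g1. \<forall>B\<in>L0 g1 g2. B \<circ> A \<in> L0 g0 g2) \<and>
     (\<forall>g0 g1 g2. \<forall>A\<in>Linf g0 g1. \<forall>B\<in>L0 g1 g2. B \<circ> A \<in> Linf g0 g2) \<and>
     (\<forall>g0 g1 g2. \<forall>A\<in>L0 g0 g1. \<forall>B\<in>Linf g1 g2. B \<circ> A \<in> Linf g0 g2) \<and>
     (\<forall>g0 g1. \<forall>A\<in>L0 g0 g1. \<exists>A'\<in>L0 g1 g0. is_adj (H g0) (H g1) A A') \<and>
     (\<forall>g0 g1. \<forall>A\<in>Linf g0 g1. \<exists>A'\<in>Linf g1 g0. is_adj (H g0) (H g1) A A')"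

definition sym_elliptic ::
  "nat \<Rightarrow> (nat \<Rightarrow> 'x set) \<Rightarrow> (nat \<Rightarrow> 'g \<Rightarrow> 'x \<Rightarrow> 'e set)
   \<Rightarrow> (nat \<Rightarrow> 'g \<Rightarrow> 'g \<Rightarrow> ('h \<Rightarrow> 'h) \<Rightarrow> 'x \<Rightarrow> ('e \<Rightarrow> 'e)) \<Rightarrow> 'g \<Rightarrow> 'g \<Rightarrow> ('h \<Rightarrow> 'h) \<Rightarrow> bool" where
  "sym_elliptic n X E \<sigma> g0 g1 A \<longleftrightarrow>
     (\<forall>l<n. \<forall>x\<in>X l. bij_betw (\<sigma> l g0 g1 A x) (E l g0 x) (E l g1 x))"

text \<open>Classical generalized operator algebra: L0 (= L0_cl) carries a principal symbol
  sigma = (sigma_0, ..., sigma_(n-1)), sigma_l(A) being a morphism E_l(g0) -> E_l(g1)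
  of Hilbert bundles over the common base X l.\<close>
definition cl_gen_op_alg ::
  "('g \<Rightarrow> 'h::{real_inner,complete_space} set) \<Rightarrow> ('g \<Rightarrow> 'g \<Rightarrow> ('h \<Rightarrow> 'h) set)
   \<Rightarrow> ('g \<Rightarrow> 'g \<Rightarrow> ('h \<Rightarrow> 'h) set) \<Rightarrow> nat \<Rightarrow> (nat \<Rightarrow> 'x set)
   \<Rightarrow> (nat \<Rightarrow> 'g \<Rightarrow> 'x \<Rightarrow> 'e::{real_inner,complete_space} set)
   \<Rightarrow> (nat \<Rightarrow> 'g \<Rightarrow> 'g \<Rightarrow> ('h \<Rightarrow> 'h) \<Rightarrow> 'x \<Rightarrow> ('e \<Rightarrow> 'e)) \<Rightarrow> bool" where
  "cl_gen_op_alg H L0 Linf n X E \<sigma> \<longleftrightarrow>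
     gen_op_alg H L0 Linf \<and>
     (\<forall>l<n. \<forall>g. \<forall>x\<in>X l. hilbert_sub (E l g x)) \<and>
     (\<forall>l<n. \<forall>g0 g1. \<forall>A\<in>L0 g0 g1. \<forall>x\<in>X l.
         bop (E l g0 x) (E l g1 x) (\<sigma> l g0 g1 A x)) \<and>
     (\<forall>l<n. \<forall>g0 g1. \<forall>A\<in>L0 g0 g1. \<forall>B\<in>L0 g0 g1. \<forall>x\<in>X l.
         \<sigma> l g0 g1 (\<lambda>y. A y + B y) x = (\<lambda>u. \<sigma> l g0 g1 A x u + \<sigma> l g0 g1 B x u)) \<and>
     (\<forall>l<n. \<forall>g0 g1 c. \<forall>A\<in>L0 g0 g1. \<forall>x\<in>X l.
         \<sigma> l g0 g1 (\<lambda>y. c *\<^sub>R A y) x = (\<lambda>u. c *\<^sub>R \<sigma> l g0 g1 A x u)) \<and>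
     (\<forall>l<n. \<forall>g0 g1 g2. \<forall>A\<in>L0 g0 g1. \<forall>B\<in>L0 g1 g2. \<forall>x\<in>X l.
         \<sigma> l g0 g2 (B \<circ> A) x = \<sigma> l g1 g2 B x \<circ> \<sigma> l g0 g1 A x) \<and>
     (\<forall>l<n. \<forall>g0 g1. \<forall>A\<in>L0 g0 g1. \<forall>A'\<in>L0 g1 g0. \<forall>x\<in>X l.
         is_adj (H g0) (H g1) A A' \<longrightarrow>
         is_adj (E l g0 x) (E l g1 x) (\<sigma> l g0 g1 A x) (\<sigma> l g1 g0 A' x)) \<and>
     (\<forall>l<n. \<forall>g0 g1. \<forall>A\<in>Linf g0 g1. \<forall>x\<in>X l. \<sigma> l g0 g1 A x = (\<lambda>_. 0)) \<and>
     (\<forall>g0 g1. \<forall>A\<in>L0 g0 g1.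
         sym_elliptic n X E \<sigma> g0 g1 A \<longleftrightarrow> has_parametrix H L0 Linf g0 g1 A)"

definition fredholm_property ::
  "('g \<Rightarrow> 'h::real_inner set) \<Rightarrow> ('g \<Rightarrow> 'g \<Rightarrow> ('h \<Rightarrow> 'h) set) \<Rightarrow> ('g \<Rightarrow> 'g \<Rightarrow> ('h \<Rightarrow> 'h) set) \<Rightarrow> bool" where
  "fredholm_property H L0 Linf \<longleftrightarrow>
     (\<forall>g0 g1. \<forall>A\<in>L0 g0 g1. has_parametrix H L0 Linf g0 g1 A \<longleftrightarrow> fredholm_op (H g0) (H g1) A)"

definition ext_fredholm_property ::
  "('g \<Rightarrow> 'h::real_inner set) \<Rightarrow> ('g \<Rightarrow> 'g \<Rightarrow> ('h \<Rightarrow> 'h) set) \<Rightarrow> ('g \<Rightarrow> 'g \<Rightarrow> ('h \<Rightarrow> 'h) set) \<Rightarrow> bool" where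
  "ext_fredholm_property H L0 Linf \<longleftrightarrow>
     fredholm_property H L0 Linf \<and>
     (\<forall>g. \<forall>A\<in>L0 g g. is_adj (H g) (H g) A A \<and> fredholm_op (H g) (H g) A \<longrightarrow>
        (\<exists>B\<in>L0 g g. \<exists>\<pi>. is_orth_proj (H g) {x\<in>H g. A x = 0} \<pi> \<and>
            A \<circ> B = (\<lambda>y. idop (H g) y - \<pi> y) \<and> B \<circ> A = (\<lambda>y. idop (H g) y - \<pi> y)))"

definition op_complex ::
  "('g \<Rightarrow> 'g \<Rightarrow> ('h::real_vector \<Rightarrow> 'h) set) \<Rightarrow> (int \<Rightarrow> 'g) \<Rightarrow> (int \<Rightarrow> 'h \<Rightarrow> 'h) \<Rightarrow> bool" where
  "op_complex L0 g A \<longleftrightarrow>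
     (\<forall>j. A j \<in> L0 (g j) (g (j + 1)) \<and> A (j + 1) \<circ> A j = (\<lambda>_. 0))"

definition elliptic_complex ::
  "nat \<Rightarrow> (nat \<Rightarrow> 'x set) \<Rightarrow> (nat \<Rightarrow> 'g \<Rightarrow> 'x \<Rightarrow> 'e::real_vector set)
   \<Rightarrow> (nat \<Rightarrow> 'g \<Rightarrow> 'g \<Rightarrow> ('h \<Rightarrow> 'h) \<Rightarrow> 'x \<Rightarrow> ('e \<Rightarrow> 'e)) \<Rightarrow> (int \<Rightarrow> 'g) \<Rightarrow> (int \<Rightarrow> 'h \<Rightarrow> 'h) \<Rightarrow> bool" where
  "elliptic_complex n X E \<sigma> g A \<longleftrightarrow>
     (\<forall>l<n. \<forall>x\<in>X l. \<forall>j.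
        {u\<in>E l (g j) x. \<sigma> l (g j) (g (j + 1)) (A j) x u = 0} =
        \<sigma> l (g (j - 1)) (g j) (A (j - 1)) x ` E l (g (j - 1)) x)"

definition laplacian ::
  "('g \<Rightarrow> 'h::real_inner set) \<Rightarrow> ('g \<Rightarrow> 'g \<Rightarrow> ('h \<Rightarrow> 'h) set) \<Rightarrow> (int \<Rightarrow> 'g) \<Rightarrow> (int \<Rightarrow> 'h \<Rightarrow> 'h)
   \<Rightarrow> int \<Rightarrow> 'h \<Rightarrow> 'h" where
  "laplacian H L0 g A j =
     (\<lambda>y. A (j - 1) (adjop H L0 (g (j - 1)) (g j) (A (j - 1)) y)
          + adjop H L0 (g j) (g (j + 1)) (A j) (A j y))"

definition complex_parametrix ::
  "('g \<Rightarrow> 'h::real_inner set) \<Rightarrow> ('g \<Rightarrow> 'g \<Rightarrow> ('h \<Rightarrow> 'h) set) \<Rightarrow> ('g \<Rightarrow> 'g \<Rightarrow> ('h \<Rightarrow> 'h) set)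
   \<Rightarrow> (int \<Rightarrow> 'g) \<Rightarrow> (int \<Rightarrow> 'h \<Rightarrow> 'h) \<Rightarrow> (int \<Rightarrow> 'h \<Rightarrow> 'h) \<Rightarrow> bool" where
  "complex_parametrix H L0 Linf g A B \<longleftrightarrow>
     (\<forall>j. B j \<in> L0 (g (j + 1)) (g j) \<and>
        (\<lambda>y. A (j - 1) (B (j - 1) y) + B j (A j y) - idop (H (g j)) y) \<in> Linf (g j) (g j))"

definition fredholm_complex ::
  "('g \<Rightarrow> 'h::real_vector set) \<Rightarrow> (int \<Rightarrow> 'g) \<Rightarrow> (int \<Rightarrow> 'h \<Rightarrow> 'h) \<Rightarrow> bool" where
  "fredholm_complex H g A \<longleftrightarrow>
     (\<forall>j. \<exists>F. finite F \<and>
        {y\<in>H (g j). A j y = 0} \<subseteq> span (F \<union> A (j - 1) ` H (g (j - 1))))"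

end

(* On a Hilbert complex
   E0 -a-> E1 -b-> E2 with closed ranges the Laplacian a a* + b* b is coercive on the orthogonal
   complement of the harmonic space ker a* \<inter> ker b, so it maps that complement onto itself; this is
   applied to the symbols, fibre by fibre (exactness makes the ranges closed), and to the operators
   themselves (finite cohomology makes the ranges closed, by the open mapping theorem).
   Conversely u = a a* v + b* b v with b u = 0 forces u = a a* v.
   Given parametrices D_j of the Laplacians, A_j \<Delta>_j = \<Delta>_{j+1} A_j shows that B_j = D_j A_j* is a
   parametrix of the complex.  A parametrix makes the identity on ker A_j a compact perturbation
   of a map into im A_{j-1}, whence finite cohomology.  If D_j inverts \<Delta>_j off its kernel exactly,
   then A_j* D_{j+1} A_{j+1}* = 0, hence B_j B_{j+1} = 0. *)
theory Submission
  imports Defs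
begin

subsection \<open>Orthogonal projections\<close>

text \<open>The Hilbert spaces and fibres are only closed subspaces of an ambient type, whereas the
  functional analysis below is stated for bounded linear maps on a whole type. Composing with the
  orthogonal projection \<open>oproj\<close> extends an operator to the ambient type, keeps its
  range and preserves adjointness; the price is a kernel enlarged by the orthogonal complement.

  The obstacle is that solving with a Laplacian off its kernel needs a lower bound, available only
  when the ranges of both neighbouring maps are closed. At position j, exactness or finite
  cohomology closes the incoming range; the outgoing one is closed by the hypothesis at j + 1. So
  the positions have to be treated together.

  A parametrix of the complex leads back to ellipticity only by a detour: it gives finite
  cohomology, this makes every Laplacian a Fredholm operator, and the Fredholm property turns that
  into a parametrix of the Laplacian. For a parametrix that is itself a complex, one more point
  matters: the projection onto the kernel of the Laplacian must be smoothing.\<close>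

lemma ex_orthogonal_projection:
  fixes S :: "'a::{real_inner,complete_space} set"
  assumes S: "hilbert_sub S"
  shows "\<exists>p\<in>S. \<forall>k\<in>S. inner (x - p) k = 0"
proof -
  have sub: "subspace S" and cl: "closed S" using S by (auto simp: hilbert_sub_def)
  define Q where "Q = (\<lambda>p. (norm (x - p))\<^sup>2) ` S"
  define D where "D = Inf Q"
  have bdd: "bdd_below Q" unfolding Q_def by (rule bdd_belowI2[of _ 0]) simp
  have ne: "Q \<noteq> {}" using subspace_0[OF sub] by (auto simp: Q_def)
  have low: "D \<le> (norm (x - p))\<^sup>2" if "p \<in> S" for p
    unfolding D_def by (rule cInf_lower[OF _ bdd]) (use that in \<open>auto simp: Q_def\<close>)
  have "\<exists>p\<in>S. (norm (x - p))\<^sup>2 < D + 1 / real (Suc n)" for n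
  proof -
    have "\<exists>q\<in>Q. q < D + 1 / real (Suc n)"
      using cInf_less_iff[OF ne bdd, of "D + 1 / real (Suc n)"] by (auto simp: D_def)
    then show ?thesis by (auto simp: Q_def)
  qed
  then obtain p where pS: "\<And>n. p n \<in> S" and p: "\<And>n. (norm (x - p n))\<^sup>2 < D + 1 / real (Suc n)"
    by metis
  \<comment> \<open>Parallelogram law for \<open>x - p m\<close> and \<open>x - p n\<close>: the
    midpoint of \<open>p m\<close> and \<open>p n\<close> lies in \<open>S\<close>, so its squared
    distance to \<open>x\<close> is at least \<open>D\<close>. This makes a minimising sequence
    Cauchy.\<close>
  have par: "(norm (p m - p n))\<^sup>2 \<le> 2 / real (Suc m) + 2 / real (Suc n)" for m n
  proof -
    have "(1/2) *\<^sub>R (p m + p n) \<in> S" using sub pS by (auto intro: subspace_scale subspace_add)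
    then have "D \<le> (norm (x - (1/2) *\<^sub>R (p m + p n)))\<^sup>2" by (rule low)
    moreover have "(norm (p m - p n))\<^sup>2 + 4 * (norm (x - (1/2) *\<^sub>R (p m + p n)))\<^sup>2 =
        2 * (norm (x - p m))\<^sup>2 + 2 * (norm (x - p n))\<^sup>2"
      unfolding power2_norm_eq_inner
      by (simp add: inner_diff_left inner_diff_right inner_add_left inner_add_right
          inner_commute algebra_simps)
    ultimately show ?thesis using p[of m] p[of n] by simp
  qed
  have "Cauchy p"
  proof (rule metric_CauchyI)
    fix e :: real assume e: "e > 0"
    obtain N :: nat where N: "N > 4 / e\<^sup>2" using reals_Archimedean2 by blast
    have "dist (p m) (p n) < e" if "m \<ge> N" "n \<ge> N" for m n
    proof -
      have "1 / real (Suc k) < e\<^sup>2 / 4" if "k \<ge> N" for k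
      proof -
        have "4 / e\<^sup>2 < real (Suc k)" using N that by linarith
        then show ?thesis using e by (simp add: field_simps)
      qed
      from this[OF that(1)] this[OF that(2)] par[of m n]
      have "(norm (p m - p n))\<^sup>2 < e\<^sup>2" by simp
      then show ?thesis using e power2_less_imp_less[of "norm (p m - p n)" e] by (simp add: dist_norm)
    qed
    then show "\<exists>M. \<forall>m\<ge>M. \<forall>n\<ge>M. dist (p m) (p n) < e" by blast
  qed
  then obtain q where q: "p \<longlonglongrightarrow> q" using Cauchy_convergent convergent_def by blast
  have qS: "q \<in> S" using closed_sequentially[OF cl _ q] pS by blast
  have qD: "(norm (x - q))\<^sup>2 \<le> D"
  proof (rule LIMSEQ_le)
    show "(\<lambda>n. (norm (x - p n))\<^sup>2) \<longlonglongrightarrow> (norm (x - q))\<^sup>2" by (intro tendsto_intros q)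
    show "(\<lambda>n. D + 1 / real (Suc n)) \<longlonglongrightarrow> D"
      using tendsto_add[OF tendsto_const[of D] LIMSEQ_inverse_real_of_nat]
      by (simp add: inverse_eq_divide)
    show "\<exists>N. \<forall>n\<ge>N. (norm (x - p n))\<^sup>2 \<le> D + 1 / real (Suc n)" using p less_imp_le by blast
  qed
  have "inner (x - q) k = 0" if k: "k \<in> S" for k
  proof (cases "k = 0")
    case False
    \<comment> \<open>This \<open>t\<close> minimises the squared norm of
      \<open>x - q - t k\<close>, the strongest choice for contradicting minimality of
      \<open>q\<close> unless \<open>c = 0\<close>.\<close>
    define c t where "c = inner (x - q) k" and "t = c / (norm k)\<^sup>2"
    have "q + t *\<^sub>R k \<in> S" using sub qS k by (auto intro: subspace_scale subspace_add)
    then have "(norm (x - q))\<^sup>2 \<le> (norm (x - (q + t *\<^sub>R k)))\<^sup>2" using low qD order_trans by blast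
    also have "\<dots> = (norm (x - q))\<^sup>2 - 2 * t * c + t\<^sup>2 * (norm k)\<^sup>2"
      unfolding power2_norm_eq_inner c_def
      by (simp add: inner_diff_left inner_diff_right inner_add_left inner_add_right
          inner_commute algebra_simps power2_eq_square)
    finally have "2 * t * c \<le> t\<^sup>2 * (norm k)\<^sup>2" by simp
    then have "c\<^sup>2 \<le> 0" using False by (simp add: t_def field_simps power2_eq_square)
    then show ?thesis by (simp add: c_def)
  qed simp
  then show ?thesis using qS by blast
qed

text \<open>Defined on the whole type, so that precomposition with it makes an operator known only
  on \<open>S\<close> total.\<close>

definition oproj :: "'a::real_inner set \<Rightarrow> 'a \<Rightarrow> 'a" where
  "oproj S x = (SOME p. p \<in> S \<and> (\<forall>k\<in>S. inner (x - p) k = 0))"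

lemma
  fixes S :: "'a::{real_inner,complete_space} set"
  assumes S: "hilbert_sub S"
  shows oproj_mem: "oproj S x \<in> S"
    and oproj_orth: "k \<in> S \<Longrightarrow> inner (x - oproj S x) k = 0"
proof -
  have "\<exists>p. p \<in> S \<and> (\<forall>k\<in>S. inner (x - p) k = 0)" using ex_orthogonal_projection[OF S] by blast
  from someI_ex[OF this] show "oproj S x \<in> S" "k \<in> S \<Longrightarrow> inner (x - oproj S x) k = 0"
    unfolding oproj_def by blast+
qed

lemma oproj_eqI:
  fixes S :: "'a::{real_inner,complete_space} set"
  assumes S: "hilbert_sub S" and p: "p \<in> S" and orth: "\<And>k. k \<in> S \<Longrightarrow> inner (x - p) k = 0"
  shows "oproj S x = p"
proof -
  let ?d = "oproj S x - p"
  have d: "?d \<in> S" using S oproj_mem[OF S] p by (auto simp: hilbert_sub_def intro: subspace_diff)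
  have "inner ?d ?d = inner (x - p) ?d - inner (x - oproj S x) ?d"
    by (simp add: inner_diff_left)
  then show ?thesis using orth[OF d] oproj_orth[OF S d] by simp
qed

lemma oproj_ident:
  fixes S :: "'a::{real_inner,complete_space} set"
  assumes "hilbert_sub S" "x \<in> S"
  shows "oproj S x = x"
  by (rule oproj_eqI) (use assms in auto)

lemma norm_oproj_le:
  fixes S :: "'a::{real_inner,complete_space} set"
  assumes S: "hilbert_sub S"
  shows "norm (oproj S x) \<le> norm x"
proof -
  have "inner (x - oproj S x) (oproj S x) = 0" by (intro oproj_orth oproj_mem S)
  then have "inner x (oproj S x) = (norm (oproj S x))\<^sup>2"
    by (simp add: inner_diff_left power2_norm_eq_inner)
  moreover have "inner x (oproj S x) \<le> norm x * norm (oproj S x)" by (rule norm_cauchy_schwarz)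
  ultimately have "norm (oproj S x) * norm (oproj S x) \<le> norm x * norm (oproj S x)"
    by (simp add: power2_eq_square)
  then show ?thesis by (cases "oproj S x = 0") auto
qed

lemma norm_diff_oproj_le:
  fixes S :: "'a::{real_inner,complete_space} set"
  assumes S: "hilbert_sub S" and n: "n \<in> S"
  shows "norm (x - oproj S x) \<le> norm (x - n)"
proof -
  define u v where "u = x - oproj S x" and "v = oproj S x - n"
  have "v \<in> S" unfolding v_def
    using S n oproj_mem[OF S] by (auto simp: hilbert_sub_def intro: subspace_diff)
  then have "inner u v = 0" unfolding u_def by (rule oproj_orth[OF S])
  then have "(norm (u + v))\<^sup>2 = (norm u)\<^sup>2 + (norm v)\<^sup>2"
    unfolding power2_norm_eq_inner by (simp add: inner_add_left inner_add_right inner_commute)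
  then have "(norm u)\<^sup>2 \<le> (norm (u + v))\<^sup>2" by simp
  then have "norm u \<le> norm (u + v)" by (rule power2_le_imp_le) simp
  then show ?thesis by (simp add: u_def v_def)
qed

lemma bounded_linear_oproj:
  fixes S :: "'a::{real_inner,complete_space} set"
  assumes S: "hilbert_sub S"
  shows "bounded_linear (oproj S)"
proof (rule bounded_linear_intro[where K = 1])
  have sub: "subspace S" using S by (simp add: hilbert_sub_def)
  show "oproj S (x + y) = oproj S x + oproj S y" for x y
  proof (rule oproj_eqI[OF S])
    show "oproj S x + oproj S y \<in> S" by (intro subspace_add[OF sub] oproj_mem S)
    show "inner (x + y - (oproj S x + oproj S y)) k = 0" if "k \<in> S" for k
      using oproj_orth[OF S that, of x] oproj_orth[OF S that, of y]
      by (simp add: inner_diff_left inner_add_left)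
  qed
  show "oproj S (c *\<^sub>R x) = c *\<^sub>R oproj S x" for c x
  proof (rule oproj_eqI[OF S])
    show "c *\<^sub>R oproj S x \<in> S" by (intro subspace_scale[OF sub] oproj_mem S)
    show "inner (c *\<^sub>R x - c *\<^sub>R oproj S x) k = 0" if "k \<in> S" for k
      using oproj_orth[OF S that, of x] by (simp add: inner_diff_left)
  qed
  show "norm (oproj S x) \<le> norm x * 1" for x using norm_oproj_le[OF S] by simp
qed

lemma oproj_selfadjoint:
  fixes S :: "'a::{real_inner,complete_space} set"
  assumes S: "hilbert_sub S"
  shows "inner (oproj S x) y = inner x (oproj S y)"
proof -
  have "inner x (oproj S y) = inner (oproj S x) (oproj S y)"
    using oproj_orth[OF S oproj_mem[OF S, of y], of x] by (simp add: inner_diff_left)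
  moreover have "inner y (oproj S x) = inner (oproj S y) (oproj S x)"
    using oproj_orth[OF S oproj_mem[OF S, of x], of y] by (simp add: inner_diff_left)
  ultimately show ?thesis by (metis inner_commute)
qed

text \<open>Gram-Schmidt: if \<open>q\<close> is the part of the new vector orthogonal to
  \<open>span F\<close>, the larger span is the preimage of \<open>span F\<close> under the
  continuous map that removes the component along \<open>q\<close>. For \<open>q = 0\<close>
  division by zero yields 0 and this map is the identity, so the same formula serves.\<close>

lemma hilbert_sub_span_finite:
  fixes F :: "'a::{real_inner,complete_space} set"
  assumes "finite F"
  shows "hilbert_sub (span F)"
  using assms
proof (induction F)
  case empty
  show ?case by (simp add: hilbert_sub_def)
next
  case (insert x F)
  define q where "q = x - oproj (span F) x"
  have orth: "inner q k = 0" if "k \<in> span F" for k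
    unfolding q_def by (rule oproj_orth[OF insert.IH that])
  have "span (insert x F) = {y. y - (inner y q / inner q q) *\<^sub>R q \<in> span F}"
  proof (intro set_eqI iffI)
    fix y assume "y \<in> span (insert x F)"
    then obtain k where k: "y - k *\<^sub>R x \<in> span F" using span_breakdown_eq by blast
    then have mem: "y - k *\<^sub>R q \<in> span F"
      using span_add[OF k span_scale[OF oproj_mem[OF insert.IH], of k x]]
      by (simp add: q_def algebra_simps)
    show "y \<in> {y. y - (inner y q / inner q q) *\<^sub>R q \<in> span F}"
    proof (cases "q = 0")
      case False
      have "inner y q = k * inner q q"
        using orth[OF mem] by (simp add: inner_diff_right inner_commute)
      then show ?thesis using mem False by simp
    qed (use mem in simp)
  next
    fix y assume "y \<in> {y. y - (inner y q / inner q q) *\<^sub>R q \<in> span F}"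
    then obtain k where k: "y - k *\<^sub>R q \<in> span F" by blast
    have "y - k *\<^sub>R x \<in> span F"
      using span_diff[OF k span_scale[OF oproj_mem[OF insert.IH], of k x]]
      by (simp add: q_def algebra_simps)
    then show "y \<in> span (insert x F)" using span_breakdown_eq by blast
  qed
  moreover have "closed {y. y - (inner y q / inner q q) *\<^sub>R q \<in> span F}"
  proof -
    have "continuous_on UNIV (\<lambda>y. y - (inner y q / inner q q) *\<^sub>R q)"
      by (cases "q = 0") (auto intro!: continuous_intros)
    moreover have "closed (span F)" using insert.IH by (simp add: hilbert_sub_def)
    ultimately have "closed ((\<lambda>y. y - (inner y q / inner q q) *\<^sub>R q) -` span F)"
      by (intro closed_vimage)
    then show ?thesis by (simp add: vimage_def)
  qed
  ultimately have "closed (span (insert x F))" by simp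
  then show ?case by (simp add: hilbert_sub_def)
qed

subsection \<open>Operators with closed range\<close>

text \<open>First half of the open mapping theorem. A closed range is a complete metric space
  covered by the closures of the images of the balls of radius n, so by Baire one of these closures
  has interior in the range. Differences of approximate preimages near an interior point give
  approximate preimages near 0, and scaling reaches every \<open>y\<close>.\<close>

lemma bounded_linear_approx_preimage:
  fixes f :: "'a::{real_normed_vector,complete_space} \<Rightarrow> 'b::{real_normed_vector,complete_space}"
  assumes f: "bounded_linear f" and cl: "closed (range f)"
  shows "\<exists>M\<ge>0. \<forall>y\<in>range f. \<exists>x. norm x \<le> M * norm y \<and> norm (y - f x) \<le> norm y / 2"
proof -
  interpret f: bounded_linear f by fact
  define C where "C n = closure (f ` cball 0 (real n))" for n :: nat
  let ?X = "top_of_set (range f)"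
  have CR: "C n \<subseteq> range f" for n unfolding C_def by (rule closure_minimal[OF _ cl]) auto
  have un: "(\<Union>n. C n) = range f"
  proof
    show "range f \<subseteq> (\<Union>n. C n)"
    proof
      fix y assume "y \<in> range f"
      then obtain x where x: "y = f x" by blast
      obtain n :: nat where "norm x \<le> real n" using real_arch_simple by blast
      then have "y \<in> C n" unfolding C_def x by (intro subsetD[OF closure_subset] imageI) simp
      then show "y \<in> (\<Union>n. C n)" by blast
    qed
  qed (use CR in blast)
  have "\<exists>n. ?X interior_of C n \<noteq> {}"
  proof (rule ccontr)
    assume "\<nexists>n. ?X interior_of C n \<noteq> {}"
    moreover have "closedin ?X (C n)" for n
      using CR by (simp add: C_def closed_subset)
    moreover have "completely_metrizable_space ?X"
      using cl by (simp add: completely_metrizable_space_closedin completely_metrizable_space_euclidean)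
    ultimately have "?X interior_of \<Union>(range C) = {}"
      by (intro Baire_category_alt) auto
    then show False using un interior_of_topspace[of ?X] by simp
  qed
  then obtain n y0 where y0: "y0 \<in> ?X interior_of C n" by blast
  then obtain U where U: "open U" "y0 \<in> U" "U \<inter> range f \<subseteq> C n" "y0 \<in> range f"
    unfolding interior_of_def openin_open by blast
  then obtain e where e: "e > 0" "ball y0 e \<subseteq> U" using openE by blast
  have near: "\<exists>x. norm x \<le> real n \<and> norm (f x - w) < e / 8"
    if "w \<in> range f" "dist y0 w < e" for w
  proof -
    have "w \<in> C n" using that subsetD[OF U(3), of w] subsetD[OF e(2), of w] by simp
    then obtain v where "v \<in> f ` cball 0 (real n)" "dist v w < e / 8"
      unfolding C_def using e closure_approachable[of w "f ` cball 0 (real n)"]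
      by (metis divide_pos_pos zero_less_numeral)
    then show ?thesis by (auto simp: dist_norm)
  qed
  have sub: "subspace (range f)" by (rule linear_subspace_image[OF f.linear subspace_UNIV])
  define M where "M = 4 * real n / e"
  have "\<exists>x. norm x \<le> M * norm y \<and> norm (y - f x) \<le> norm y / 2" if y: "y \<in> range f" for y
  proof (cases "y = 0")
    case True
    then show ?thesis by (intro exI[of _ 0]) (simp add: f.zero)
  next
    case False
    \<comment> \<open>Scaling \<open>y\<close> to norm e/2 keeps \<open>y0 + z\<close> in the ball
      around \<open>y0\<close>. The two errors e/8 add up to e/4, which becomes half the norm of
      \<open>y\<close> after division by \<open>s\<close>; likewise the bound 2n on
      \<open>x1 - x2\<close> becomes \<open>M * norm y\<close>.\<close>
    define s where "s = e / (2 * norm y)"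
    have s: "s > 0" using e False by (simp add: s_def)
    define z where "z = s *\<^sub>R y"
    have z: "norm z < e" using e False by (simp add: z_def s_def)
    have "y0 + z \<in> range f" unfolding z_def by (intro subspace_add subspace_scale sub U y)
    then obtain x1 where x1: "norm x1 \<le> real n" "norm (f x1 - (y0 + z)) < e / 8"
      using near[of "y0 + z"] z by (auto simp: dist_norm)
    obtain x2 where x2: "norm x2 \<le> real n" "norm (f x2 - y0) < e / 8"
      using near[of y0] U e by auto
    define x where "x = (1 / s) *\<^sub>R (x1 - x2)"
    have "norm (x1 - x2) \<le> 2 * real n" using norm_triangle_ineq4[of x1 x2] x1 x2 by linarith
    then have "norm x \<le> (1 / s) * (2 * real n)" using s by (simp add: x_def divide_right_mono)
    also have "\<dots> = M * norm y" by (simp add: M_def s_def)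
    finally have nx: "norm x \<le> M * norm y" .
    have "norm (z - f (x1 - x2)) = norm ((f x1 - (y0 + z)) - (f x2 - y0))"
      by (simp add: f.diff norm_minus_commute algebra_simps)
    also have "\<dots> \<le> e / 4" using norm_triangle_ineq4[of "f x1 - (y0 + z)" "f x2 - y0"] x1 x2 by linarith
    finally have le: "norm (z - f (x1 - x2)) \<le> e / 4" .
    have "y - f x = (1 / s) *\<^sub>R (z - f (x1 - x2))"
      using s by (simp add: x_def z_def f.scaleR f.diff scaleR_diff_right)
    then have "norm (y - f x) = (1 / s) * norm (z - f (x1 - x2))" using s by simp
    also have "\<dots> \<le> (1 / s) * (e / 4)" using s le by (intro mult_left_mono) auto
    also have "\<dots> = norm y / 2" using e by (simp add: s_def)
    finally show ?thesis using nx by blast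
  qed
  moreover have "M \<ge> 0" using e by (simp add: M_def)
  ultimately show ?thesis by blast
qed

text \<open>Second half of the open mapping theorem: approximating the residual again and again
  halves it each time, so the corrections form a geometric series with total norm at most 2 M times
  the norm of \<open>y\<close>. The 1 added to the constant makes it positive even if
  \<open>M = 0\<close>.\<close>

lemma bounded_linear_closed_range_preimage:
  fixes f :: "'a::{real_normed_vector,complete_space} \<Rightarrow> 'b::{real_normed_vector,complete_space}"
  assumes f: "bounded_linear f" and cl: "closed (range f)"
  shows "\<exists>C>0. \<forall>y\<in>range f. \<exists>x. f x = y \<and> norm x \<le> C * norm y"
proof -
  interpret f: bounded_linear f by fact
  obtain M where M: "M \<ge> 0"
    and "\<forall>y\<in>range f. \<exists>x. norm x \<le> M * norm y \<and> norm (y - f x) \<le> norm y / 2"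
    using bounded_linear_approx_preimage[OF assms] by blast
  then obtain h where h: "\<And>y. y \<in> range f \<Longrightarrow> norm (h y) \<le> M * norm y"
    and h2: "\<And>y. y \<in> range f \<Longrightarrow> norm (y - f (h y)) \<le> norm y / 2"
    by metis
  have sub: "subspace (range f)" by (rule linear_subspace_image[OF f.linear subspace_UNIV])
  have "\<exists>x. f x = y \<and> norm x \<le> (2 * M + 1) * norm y" if y: "y \<in> range f" for y
  proof -
    define r where "r k = ((\<lambda>y. y - f (h y)) ^^ k) y" for k
    define X where "X k = (\<Sum>i<k. h (r i))" for k
    have r_Suc: "r (Suc k) = r k - f (h (r k))" for k by (simp add: r_def)
    have rR: "r k \<in> range f" for k
      by (induction k) (auto simp: r_Suc r_def y intro: subspace_diff[OF sub])
    have rn: "norm (r k) \<le> norm y / 2 ^ k" for k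
    proof (induction k)
      case (Suc k)
      show ?case using h2[OF rR[of k]] Suc by (simp add: r_Suc)
    qed (simp add: r_def)
    have fX: "f (X k) = y - r k" for k
      by (induction k) (simp_all add: X_def f.zero f.add r_Suc, simp add: r_def)
    define c where "c = M * norm y"
    have step: "norm (X (Suc k) - X k) \<le> c / 2 ^ k" for k
    proof -
      have "norm (X (Suc k) - X k) \<le> M * norm (r k)" using h[OF rR] by (simp add: X_def)
      also have "\<dots> \<le> M * (norm y / 2 ^ k)" by (intro mult_left_mono rn M)
      finally show ?thesis by (simp add: c_def)
    qed
    \<comment> \<open>The geometric sum in closed form, which lets the induction telescope.\<close>
    have tail: "norm (X (m + j) - X m) \<le> 2 * c / 2 ^ m - 2 * c / 2 ^ (m + j)" for m j
    proof (induction j)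
      case (Suc j)
      have "norm (X (m + Suc j) - X m) \<le> norm (X (Suc (m + j)) - X (m + j)) + norm (X (m + j) - X m)"
        using norm_triangle_ineq[of "X (Suc (m + j)) - X (m + j)" "X (m + j) - X m"] by simp
      also have "\<dots> \<le> c / 2 ^ (m + j) + (2 * c / 2 ^ m - 2 * c / 2 ^ (m + j))"
        by (intro add_mono step Suc)
      also have "\<dots> = 2 * c / 2 ^ m - 2 * c / 2 ^ (m + Suc j)" by (simp add: field_simps)
      finally show ?case .
    qed simp
    have c: "c \<ge> 0" using M by (simp add: c_def)
    have tail2: "norm (X k - X m) \<le> 2 * c / 2 ^ m" if "k \<ge> m" for k m
    proof -
      have "0 \<le> 2 * c / 2 ^ k" using c by simp
      then show ?thesis using tail[of m "k - m"] that by simp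
    qed
    have geo: "(\<lambda>m. K / 2 ^ m) \<longlonglongrightarrow> 0" for K :: real
      using tendsto_mult_right_zero[OF LIMSEQ_realpow_zero[of "1/2"], of K]
      by (simp add: power_one_over field_simps)
    have "Cauchy X"
    proof (rule CauchyI')
      fix e :: real assume "e > 0"
      then obtain N where N: "2 * c / 2 ^ N < e"
        using order_tendstoD(2)[OF geo[of "2 * c"], of e] by (auto simp: eventually_sequentially)
      have "dist (X m) (X k) < e" if "m \<ge> N" "k > m" for m k
      proof -
        have "2 * c / 2 ^ m \<le> 2 * c / 2 ^ N"
          using c that by (intro divide_left_mono power_increasing) auto
        then show ?thesis
          using N tail2[of m k] that by (simp add: dist_norm norm_minus_commute)
      qed
      then show "\<exists>M. \<forall>m\<ge>M. \<forall>n>m. dist (X m) (X n) < e" by blast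
    qed
    then obtain x where x: "X \<longlonglongrightarrow> x" using Cauchy_convergent convergent_def by blast
    have "(\<lambda>k. norm (r k)) \<longlonglongrightarrow> 0"
      by (rule tendsto_sandwich[OF _ _ tendsto_const geo[of "norm y"]]) (simp_all add: rn)
    then have "(\<lambda>k. y - r k) \<longlonglongrightarrow> y - 0"
      by (intro tendsto_intros) (simp add: tendsto_norm_zero_iff)
    moreover have "(\<lambda>k. f (X k)) \<longlonglongrightarrow> f x" by (rule f.tendsto[OF x])
    ultimately have "f x = y" by (simp add: fX LIMSEQ_unique)
    moreover have "norm x \<le> 2 * c"
    proof (rule LIMSEQ_le_const2)
      show "(\<lambda>k. norm (X k)) \<longlonglongrightarrow> norm x" by (rule tendsto_norm[OF x])
      show "\<exists>N. \<forall>n\<ge>N. norm (X n) \<le> 2 * c" using tail2[of 0] by (simp add: X_def)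
    qed
    moreover have "2 * c \<le> (2 * M + 1) * norm y" by (simp add: c_def algebra_simps)
    ultimately show ?thesis by (metis order_trans)
  qed
  then show ?thesis using M by (intro exI[of _ "2 * M + 1"]) auto
qed

text \<open>Greedy selection: a vector is kept only if it is not yet in the span of \<open>R\<close>
  and the vectors kept so far. The kept vectors are then independent modulo
  \<open>R\<close>.\<close>

lemma finite_complement_of_subspace:
  fixes R :: "'a::real_vector set"
  assumes "finite F" and R: "subspace R"
  shows "\<exists>F'\<subseteq>F. span (F \<union> R) \<subseteq> span (F' \<union> R) \<and> span F' \<inter> R = {0}"
  using assms(1)
proof (induction F)
  case empty
  have "span {} \<inter> R = {0}" using subspace_0[OF R] by simp
  then show ?case by blast
next
  case (insert x F)
  from insert.IH obtain F' where F': "F' \<subseteq> F"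
    "span (F \<union> R) \<subseteq> span (F' \<union> R)" "span F' \<inter> R = {0}"
    by (elim exE conjE) (rule that)
  show ?case
  proof (cases "x \<in> span (F' \<union> R)")
    case True
    have "F \<union> R \<subseteq> span (F' \<union> R)" by (rule order_trans[OF span_superset F'(2)])
    then have "span (insert x F \<union> R) \<subseteq> span (F' \<union> R)"
      using True by (intro span_minimal) auto
    then show ?thesis using F'(1,3) by blast
  next
    case False
    have "F \<union> R \<subseteq> span (F' \<union> R)" by (rule order_trans[OF span_superset F'(2)])
    then have "F \<union> R \<subseteq> span (insert x F' \<union> R)"
      using span_mono[of "F' \<union> R" "insert x F' \<union> R"] by (simp add: subset_iff)
    then have sp: "span (insert x F \<union> R) \<subseteq> span (insert x F' \<union> R)"
      by (intro span_minimal) (auto intro: span_base)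
    have "r = 0" if r: "r \<in> span (insert x F')" "r \<in> R" for r
    proof -
      obtain k where k: "r - k *\<^sub>R x \<in> span F'"
        using r(1) unfolding span_breakdown_eq by blast
      have "k = 0"
      proof (rule ccontr)
        assume "k \<noteq> 0"
        have "r - k *\<^sub>R x \<in> span (F' \<union> R)" by (rule subsetD[OF span_mono k]) simp
        moreover have "r \<in> span (F' \<union> R)" using r by (intro span_base) simp
        ultimately have "k *\<^sub>R x \<in> span (F' \<union> R)"
          using span_diff[of r "F' \<union> R" "r - k *\<^sub>R x"] by simp
        then have "(1 / k) *\<^sub>R (k *\<^sub>R x) \<in> span (F' \<union> R)" by (rule span_scale)
        then show False using \<open>k \<noteq> 0\<close> False by simp
      qed
      then have "r \<in> span F' \<inter> R" using k r by simp
      then show ?thesis using F'(3) by simp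
    qed
    then have "span (insert x F') \<inter> R = {0}" using span_0[of "insert x F'"] subspace_0[OF R] by blast
    moreover have "insert x F' \<subseteq> insert x F" using F'(1) by blast
    ultimately show ?thesis using sp by blast
  qed
qed

text \<open>Adding a finite-dimensional complement \<open>G\<close> of the range as a second factor
  gives a map onto the closed space \<open>T\<close>, which has bounded preimages. The
  \<open>G\<close>-component of an element of \<open>T\<close> is unique and therefore bounded by
  its norm. If \<open>y n\<close> in the range tends to \<open>l\<close>, the
  \<open>G\<close>-component of \<open>l\<close> equals that of \<open>l - y n\<close>, so it is
  0.\<close>

lemma closed_range_finite_codim:
  fixes f :: "'a::{real_inner,complete_space} \<Rightarrow> 'b::{real_inner,complete_space}"
  assumes f: "bounded_linear f" and T: "hilbert_sub T" and fT: "range f \<subseteq> T"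
    and F: "finite F" and TF: "T \<subseteq> span (F \<union> range f)"
  shows "closed (range f)"
proof -
  interpret f: bounded_linear f by fact
  have R: "subspace (range f)" by (rule linear_subspace_image[OF f.linear subspace_UNIV])
  obtain F' where F': "F' \<subseteq> F" "span (F \<union> range f) \<subseteq> span (F' \<union> range f)"
    "span F' \<inter> range f = {0}"
    using finite_complement_of_subspace[OF F R] by blast
  \<comment> \<open>The vectors of \<open>F'\<close> may lie outside \<open>T\<close>; the
    intersection still meets every coset of the range in \<open>T\<close>, because the range is
    contained in \<open>T\<close>.\<close>
  define G where "G = span F' \<inter> T"
  have "hilbert_sub (span F')" by (intro hilbert_sub_span_finite finite_subset[OF F'(1) F])
  then have G: "hilbert_sub G"
    using T by (simp add: hilbert_sub_def G_def subspace_inter closed_Int)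
  define h where "h z = f (fst z) + oproj G (snd z)" for z :: "'a \<times> 'b"
  have h: "bounded_linear h"
    unfolding h_def
    by (intro bounded_linear_add bounded_linear_compose[OF f] bounded_linear_fst
        bounded_linear_compose[OF bounded_linear_oproj[OF G]] bounded_linear_snd)
  have subT: "subspace T" using T by (simp add: hilbert_sub_def)
  have rh: "range h = T"
  proof
    show "range h \<subseteq> T"
    proof -
      have "h z \<in> T" for z
        unfolding h_def using fT oproj_mem[OF G, of "snd z"]
        by (intro subspace_add[OF subT]) (auto simp: G_def)
      then show ?thesis by blast
    qed
    show "T \<subseteq> range h"
    proof
      fix y assume y: "y \<in> T"
      then have "y \<in> span (F' \<union> range f)" using TF F'(2) by blast
      then obtain u v where uv: "y = u + v" "u \<in> span F'" "v \<in> span (range f)"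
        unfolding span_Un by blast
      moreover have "span (range f) = range f" using R by (simp only: span_eq_iff)
      ultimately obtain x where x: "v = f x" by blast
      have "y - v \<in> T" using y x fT by (intro subspace_diff[OF subT]) auto
      then have "u \<in> G" using uv by (simp add: G_def)
      then have "h (x, u) = y" using uv x by (simp add: h_def oproj_ident[OF G])
      then show "y \<in> range h" by blast
    qed
  qed
  moreover have "closed T" using T by (simp add: hilbert_sub_def)
  ultimately obtain C where C: "C > 0" "\<forall>y\<in>T. \<exists>z. h z = y \<and> norm z \<le> C * norm y"
    using bounded_linear_closed_range_preimage[OF h] by auto
  show ?thesis unfolding closed_sequential_limits
  proof (intro allI impI)
    fix y l assume yl: "(\<forall>n. y n \<in> range f) \<and> y \<longlonglongrightarrow> l"
    then have yT: "y n \<in> T" for n using fT by blast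
    have l: "l \<in> T" using closed_sequentially[OF \<open>closed T\<close>, of y l] yT yl by blast
    then obtain z where z: "h z = l" using rh by (metis imageE)
    define u where "u = oproj G (snd z)"
    have "norm u \<le> C * norm (l - y n)" for n
    proof -
      have "l - y n \<in> T" by (intro subspace_diff[OF subT] l yT)
      then obtain w where w: "h w = l - y n" "norm w \<le> C * norm (l - y n)" using C by blast
      obtain x where x: "y n = f x" using yl by blast
      have eq: "u - oproj G (snd w) = f (fst w + x - fst z)"
        using w(1) z x by (simp add: h_def u_def f.add f.diff algebra_simps)
      have "u - oproj G (snd w) \<in> span F'"
        unfolding u_def using oproj_mem[OF G] by (intro span_diff) (simp_all add: G_def)
      then have "u - oproj G (snd w) = 0" using eq F'(3) by (metis IntI rangeI singletonD)
      then have "norm u \<le> norm (snd w)" using norm_oproj_le[OF G] by simp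
      also have "\<dots> \<le> norm w" using norm_snd_le[of "snd w" "fst w"] by simp
      finally show ?thesis using w(2) by simp
    qed
    moreover have "(\<lambda>n. C * norm (l - y n)) \<longlonglongrightarrow> C * norm (l - l)"
      using yl by (intro tendsto_intros) auto
    ultimately have "norm u \<le> 0" by (intro LIMSEQ_le_const) auto
    then have "l = f (fst z)" using z by (simp add: h_def flip: u_def)
    then show "l \<in> range f" by blast
  qed
qed

subsection \<open>Coercive operators and the Hodge decomposition\<close>

text \<open>For small \<open>t\<close> the map \<open>u \<mapsto> u - t (T u - v)\<close> is a contraction whose fixed point solves
  \<open>T u = v\<close>.\<close>
lemma coercive_surj:
  fixes T :: "'a::{real_inner,complete_space} \<Rightarrow> 'a"
  assumes T: "bounded_linear T" and V: "hilbert_sub V" and TV: "T ` V \<subseteq> V"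
    and c: "c > 0" and coer: "\<And>u. u \<in> V \<Longrightarrow> c * (norm u)\<^sup>2 \<le> inner (T u) u"
    and v: "v \<in> V"
  shows "\<exists>u\<in>V. T u = v"
proof -
  interpret T: bounded_linear T by fact
  have sub: "subspace V" and cl: "closed V" using V by (auto simp: hilbert_sub_def)
  obtain K where K: "\<And>x. norm (T x) \<le> norm x * K" using T.bounded by blast
  \<comment> \<open>The maximum with \<open>c\<close> ensures \<open>M > 0\<close> and
    \<open>c \<le> M\<close>, so the square root in \<open>q\<close> below is taken of a nonnegative
    number.\<close>
  define M where "M = max K c"
  have M: "M > 0" "c \<le> M" using c by (auto simp: M_def)
  have TM: "norm (T x) \<le> M * norm x" for x
    using K[of x] mult_left_mono[of K M "norm x"] by (simp add: M_def mult.commute)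
  \<comment> \<open>Minimiser of 1 - 2 t c + t^2 M^2, an upper bound for the squared contraction
    factor; its minimal value is \<open>q\<close> squared.\<close>
  define t where "t = c / M\<^sup>2"
  define q where "q = sqrt (1 - c\<^sup>2 / M\<^sup>2)"
  have "c\<^sup>2 \<le> M\<^sup>2" using M c by (intro power_mono) auto
  then have q2: "0 \<le> 1 - c\<^sup>2 / M\<^sup>2" "1 - c\<^sup>2 / M\<^sup>2 < 1" using M c by auto
  then have q: "0 \<le> q" "q < 1" by (auto simp: q_def)
  define \<phi> where "\<phi> u = u - t *\<^sub>R (T u - v)" for u
  have "\<exists>!u. u \<in> V \<and> \<phi> u = u"
  proof (rule Banach_fix[of V q \<phi>])
    show "complete V" using cl by (simp add: complete_eq_closed)
    show "V \<noteq> {}" using v by blast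
    show "0 \<le> q" "q < 1" using q by auto
    show "\<phi> ` V \<subseteq> V"
      using TV v by (auto simp: \<phi>_def intro!: subspace_diff[OF sub] subspace_scale[OF sub])
    show "dist (\<phi> u) (\<phi> w) \<le> q * dist u w" if "u \<in> V" "w \<in> V" for u w
    proof -
      define d where "d = u - w"
      have d: "d \<in> V" unfolding d_def by (intro subspace_diff[OF sub] that)
      have "(norm (T d))\<^sup>2 \<le> (M * norm d)\<^sup>2" using TM by (intro power_mono) auto
      then have "t\<^sup>2 * (norm (T d))\<^sup>2 \<le> t\<^sup>2 * (M\<^sup>2 * (norm d)\<^sup>2)"
        by (intro mult_left_mono) (auto simp: power_mult_distrib)
      moreover have "2 * t * (c * (norm d)\<^sup>2) \<le> 2 * t * inner (T d) d"
        using c by (intro mult_left_mono coer d) (simp add: t_def)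
      moreover have "(norm (d - t *\<^sub>R T d))\<^sup>2 =
          (norm d)\<^sup>2 - 2 * t * inner (T d) d + t\<^sup>2 * (norm (T d))\<^sup>2"
        unfolding power2_norm_eq_inner
        by (simp add: inner_diff_left inner_diff_right inner_commute power2_eq_square algebra_simps)
      ultimately have "(norm (d - t *\<^sub>R T d))\<^sup>2 \<le>
          (norm d)\<^sup>2 - 2 * t * (c * (norm d)\<^sup>2) + t\<^sup>2 * (M\<^sup>2 * (norm d)\<^sup>2)" by linarith
      also have "\<dots> = (1 - c\<^sup>2 / M\<^sup>2) * (norm d)\<^sup>2"
        using M by (simp add: t_def power2_eq_square field_simps)
      also have "\<dots> = (q * norm d)\<^sup>2" using q2 by (simp add: q_def power_mult_distrib)
      finally have "norm (d - t *\<^sub>R T d) \<le> q * norm d"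
        using q power2_le_imp_le by (metis mult_nonneg_nonneg norm_ge_zero)
      moreover have "\<phi> u - \<phi> w = d - t *\<^sub>R T d"
        by (simp add: \<phi>_def d_def T.diff algebra_simps)
      ultimately show ?thesis by (simp add: dist_norm d_def)
    qed
  qed
  then obtain u where u: "u \<in> V" "t *\<^sub>R (T u - v) = 0" by (auto simp: \<phi>_def)
  then have "T u = v" using c M by (simp add: t_def)
  then show ?thesis using u by blast
qed

lemma hilbert_sub_orth:
  fixes N :: "'a::{real_inner,complete_space} set"
  shows "hilbert_sub {v. \<forall>k\<in>N. inner v k = 0}"
proof -
  have "closed (\<Inter>k\<in>N. {v. inner v k = 0})"
    by (intro closed_INT ballI closed_Collect_eq continuous_intros)
  moreover have "(\<Inter>k\<in>N. {v. inner v k = 0}) = {v. \<forall>k\<in>N. inner v k = 0}" by auto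
  ultimately show ?thesis
    by (auto simp: hilbert_sub_def subspace_def inner_add_left)
qed

text \<open>Both bounds come from preimages of controlled norm. If \<open>y = a x\<close>, pair
  \<open>y\<close> with itself and move \<open>a\<close> across. If \<open>u\<close> is orthogonal
  to the kernel of \<open>a\<close> and \<open>a x = a u\<close>, then \<open>u - x\<close> is in
  that kernel, so \<open>u\<close> is no longer than \<open>x\<close>. In the Hodge argument the
  first bound serves the incoming map and the second the outgoing one.\<close>

lemma adjoint_bounded_below:
  fixes a :: "'a::{real_inner,complete_space} \<Rightarrow> 'b::{real_inner,complete_space}"
  assumes a: "bounded_linear a" and adj: "\<And>x y. inner (a x) y = inner x (a' y)"
    and cl: "closed (range a)"
  shows "\<exists>C>0. (\<forall>y\<in>range a. norm y \<le> C * norm (a' y)) \<and>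
    (\<forall>u. (\<forall>k. a k = 0 \<longrightarrow> inner u k = 0) \<longrightarrow> norm u \<le> C * norm (a u))"
proof -
  interpret a: bounded_linear a by fact
  obtain C where C: "C > 0" "\<forall>y\<in>range a. \<exists>x. a x = y \<and> norm x \<le> C * norm y"
    using bounded_linear_closed_range_preimage[OF a cl] by blast
  have "norm y \<le> C * norm (a' y)" if y: "y \<in> range a" for y
  proof (cases "y = 0")
    case False
    obtain x where x: "a x = y" "norm x \<le> C * norm y" using C y by blast
    have "norm y * norm y = inner x (a' y)" using adj[of x y] x by (simp add: power2_norm_eq_inner flip: power2_eq_square)
    also have "\<dots> \<le> norm x * norm (a' y)" by (rule norm_cauchy_schwarz)
    also have "\<dots> \<le> (C * norm y) * norm (a' y)" by (intro mult_right_mono x) auto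
    finally have "norm y * norm y \<le> norm y * (C * norm (a' y))" by (simp add: algebra_simps)
    then show ?thesis using False by simp
  qed (use C in auto)
  moreover have "norm u \<le> C * norm (a u)" if u: "\<And>k. a k = 0 \<Longrightarrow> inner u k = 0" for u
  proof (cases "u = 0")
    case False
    obtain x where x: "a x = a u" "norm x \<le> C * norm (a u)" using C by blast
    have "inner u (u - x) = 0" by (rule u) (simp add: a.diff x)
    then have "norm u * norm u = inner u x"
      by (simp add: inner_diff_right power2_norm_eq_inner flip: power2_eq_square)
    also have "\<dots> \<le> norm u * norm x" by (rule norm_cauchy_schwarz)
    finally have "norm u \<le> norm x" using False by simp
    then show ?thesis using x by simp
  qed (use C in auto)
  ultimately show ?thesis using C(1) by blast
qed

text \<open>The Laplacian is coercive on the orthogonal complement of the harmonic elements.\<close>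
lemma hodge_surj:
  fixes a :: "'a::{real_inner,complete_space} \<Rightarrow> 'b::{real_inner,complete_space}"
    and b :: "'b \<Rightarrow> 'c::{real_inner,complete_space}"
  assumes a: "bounded_linear a" and b: "bounded_linear b"
    and a': "bounded_linear a'" and b': "bounded_linear b'"
    and adja: "\<And>x y. inner (a x) y = inner x (a' y)"
    and adjb: "\<And>x y. inner (b x) y = inner x (b' y)"
    and ba: "\<And>x. b (a x) = 0"
    and cla: "closed (range a)" and clb: "closed (range b)"
    and v: "\<And>k. a' k = 0 \<Longrightarrow> b k = 0 \<Longrightarrow> inner v k = 0"
  shows "\<exists>u. a (a' u) + b' (b u) = v"
proof -
  interpret a: bounded_linear a by fact
  interpret b: bounded_linear b by fact
  interpret a': bounded_linear a' by fact
  interpret b': bounded_linear b' by fact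
  define N where "N = {k. a' k = 0 \<and> b k = 0}"
  define V where "V = {v. \<forall>k\<in>N. inner v k = 0}"
  define T where "T u = a (a' u) + b' (b u)" for u
  have T: "bounded_linear T"
    unfolding T_def
    by (intro bounded_linear_add bounded_linear_compose[OF a] bounded_linear_compose[OF b'] a' b)
  \<comment> \<open>The form is symmetric and vanishes when \<open>w\<close> is harmonic; this
    yields both coercivity and the invariance of \<open>V\<close>.\<close>
  have TT: "inner (T u) w = inner (a' u) (a' w) + inner (b u) (b w)" for u w
    by (simp add: T_def inner_add_left adja) (metis adjb inner_commute)
  have hR: "hilbert_sub (range a)"
    using linear_subspace_image[OF a.linear subspace_UNIV] cla by (simp add: hilbert_sub_def)
  obtain C1 where C1: "C1 > 0" "\<And>y. y \<in> range a \<Longrightarrow> norm y \<le> C1 * norm (a' y)"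
    using adjoint_bounded_below[OF a adja cla] by blast
  obtain C2 where C2: "C2 > 0" "\<And>u. (\<And>k. b k = 0 \<Longrightarrow> inner u k = 0) \<Longrightarrow> norm u \<le> C2 * norm (b u)"
    using adjoint_bounded_below[OF b adjb clb] by blast
  have a'0: "a' (x - oproj (range a) x) = 0" for x
  proof -
    let ?r = "x - oproj (range a) x"
    have "inner (a' ?r) (a' ?r) = inner (a (a' ?r)) ?r" by (simp add: adja)
    also have "\<dots> = 0" using oproj_orth[OF hR, of "a (a' ?r)" x] by (simp add: inner_commute)
    finally show ?thesis by simp
  qed
  have bp: "b (oproj (range a) x) = 0" for x
    using oproj_mem[OF hR, of x] ba by auto
  define c where "c = 1 / (max C1 C2)\<^sup>2"
  have c: "c > 0" using C1 by (simp add: c_def less_max_iff_disj)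
  have coer: "c * (norm u)\<^sup>2 \<le> inner (T u) u" if u: "u \<in> V" for u
  proof -
    define p r where "p = oproj (range a) u" and "r = u - p"
    have p: "p \<in> range a" unfolding p_def by (rule oproj_mem[OF hR])
    have r0: "a' r = 0" using a'0[of u] by (simp add: r_def p_def)
    have p0: "b p = 0" using bp[of u] by (simp add: p_def)
    have up: "u = p + r" by (simp add: r_def)
    \<comment> \<open>The kernel of \<open>b\<close> is the orthogonal sum of the range of
      \<open>a\<close> and the harmonic space \<open>N\<close>: \<open>k\<close> splits into
      \<open>k1\<close> and \<open>k - k1\<close>. The vector \<open>r\<close> is orthogonal to the
      first by construction, and to the second because \<open>u\<close> and \<open>p\<close> are.
      Hence the lower bound for \<open>b\<close> applies to \<open>r\<close>.\<close>
    have rk: "inner r k = 0" if k: "b k = 0" for k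
    proof -
      define k1 where "k1 = oproj (range a) k"
      have k1: "k1 \<in> range a" unfolding k1_def by (rule oproj_mem[OF hR])
      have "k - k1 \<in> N" using a'0[of k] bp[of k] k by (simp add: N_def k1_def b.diff)
      then have "inner u (k - k1) = 0" using u by (simp add: V_def)
      moreover have "inner p (k - k1) = 0"
        using oproj_orth[OF hR p, of k] by (simp add: k1_def inner_commute)
      moreover have "inner r k1 = 0" unfolding r_def p_def by (rule oproj_orth[OF hR k1])
      ultimately show ?thesis by (simp add: r_def inner_diff_left inner_diff_right)
    qed
    let ?C = "max C1 C2"
    have "norm p \<le> C1 * norm (a' p)" by (rule C1(2)[OF p])
    also have "\<dots> \<le> ?C * norm (a' p)" by (intro mult_right_mono) auto
    finally have 1: "norm p \<le> ?C * norm (a' u)" by (simp add: up a'.add r0)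
    have "norm r \<le> C2 * norm (b r)" by (rule C2(2)[OF rk])
    also have "\<dots> \<le> ?C * norm (b r)" by (intro mult_right_mono) auto
    finally have 2: "norm r \<le> ?C * norm (b u)" by (simp add: up b.add p0)
    have "inner p r = 0" using rk[OF p0] by (simp add: inner_commute)
    then have "(norm u)\<^sup>2 = (norm p)\<^sup>2 + (norm r)\<^sup>2"
      by (simp add: up power2_norm_eq_inner inner_add_left inner_add_right inner_commute)
    also have "\<dots> \<le> (?C * norm (a' u))\<^sup>2 + (?C * norm (b u))\<^sup>2"
      by (intro add_mono power_mono 1 2) auto
    also have "\<dots> = ?C\<^sup>2 * inner (T u) u"
      by (simp add: TT power_mult_distrib power2_norm_eq_inner algebra_simps)
    finally have "(norm u)\<^sup>2 \<le> ?C\<^sup>2 * inner (T u) u" .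
    moreover have "?C > 0" using C1 by auto
    ultimately show ?thesis by (simp add: c_def divide_le_eq mult.commute)
  qed
  have "v \<in> V" using v by (auto simp: V_def N_def)
  moreover have "T ` V \<subseteq> V" by (auto simp: V_def TT N_def)
  moreover have "hilbert_sub V" unfolding V_def by (rule hilbert_sub_orth)
  ultimately have "\<exists>u\<in>V. T u = v" using coercive_surj[OF T _ _ c coer] by blast
  then show ?thesis by (auto simp: T_def)
qed

section \<open>Compact perturbations of the identity\<close>

text \<open>\<open>K\<close> is within distance \<open>1/2\<close> of a finite rank operator, so \<open>1 + K\<close> is coercive up to a
  finite rank error.\<close>
lemma finite_codim_id_plus_compact:
  fixes K :: "'a::{real_inner,complete_space} \<Rightarrow> 'a"
  assumes K: "bounded_linear K" and S: "hilbert_sub S" and KS: "K ` S \<subseteq> S"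
    and cpt: "compact (closure (K ` (S \<inter> cball 0 1)))"
  shows "\<exists>N. finite N \<and> S \<subseteq> span (N \<union> (\<lambda>x. x + K x) ` S)"
proof -
  interpret K: bounded_linear K by fact
  have sub: "subspace S" and cl: "closed S" using S by (auto simp: hilbert_sub_def)
  obtain N where N: "finite N" "N \<subseteq> closure (K ` (S \<inter> cball 0 1))"
    "closure (K ` (S \<inter> cball 0 1)) \<subseteq> (\<Union>x\<in>N. ball x (1/2))"
    using seq_compact_imp_totally_bounded[OF cpt[unfolded compact_eq_seq_compact_metric]]
    by (meson half_gt_zero zero_less_one)
  have "closure (K ` (S \<inter> cball 0 1)) \<subseteq> S" using KS by (intro closure_minimal cl) auto
  \<comment> \<open>Since the net lies in \<open>S\<close>, the projection onto its span maps into
    \<open>S\<close>, and so \<open>T\<close> leaves \<open>S\<close> invariant.\<close>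
  then have NS: "N \<subseteq> S" using N by blast
  then have spS: "span N \<subseteq> S" by (intro span_minimal sub)
  define P where "P = oproj (span N)"
  have hN: "hilbert_sub (span N)" by (rule hilbert_sub_span_finite[OF N(1)])
  interpret P: bounded_linear P unfolding P_def by (rule bounded_linear_oproj[OF hN])
  define T where "T x = x + (K x - P (K x))" for x
  have T: "bounded_linear T" unfolding T_def
    by (intro bounded_linear_add bounded_linear_ident bounded_linear_sub K
        bounded_linear_compose[OF P.bounded_linear_axioms K])
  have unit: "norm (K x - P (K x)) \<le> 1/2" if x: "x \<in> S" "norm x \<le> 1" for x
  proof -
    have "K x \<in> closure (K ` (S \<inter> cball 0 1))"
      using x by (intro subsetD[OF closure_subset] imageI) auto
    then obtain m where m: "m \<in> N" "dist m (K x) < 1/2" using N(3) by auto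
    have "norm (K x - P (K x)) \<le> norm (K x - m)"
      unfolding P_def by (intro norm_diff_oproj_le hN span_base m)
    then show ?thesis using m by (simp add: dist_norm norm_minus_commute)
  qed
  have half: "norm (K x - P (K x)) \<le> norm x / 2" if x: "x \<in> S" for x
  proof (cases "x = 0")
    case False
    let ?s = "1 / norm x"
    have "norm (K (?s *\<^sub>R x) - P (K (?s *\<^sub>R x))) \<le> 1/2"
      using False by (intro unit subspace_scale[OF sub] x) simp
    also have "K (?s *\<^sub>R x) - P (K (?s *\<^sub>R x)) = ?s *\<^sub>R (K x - P (K x))"
      by (simp only: K.scaleR P.scaleR scaleR_diff_right)
    finally have "?s * norm (K x - P (K x)) \<le> 1/2" by simp
    then show ?thesis using False by (simp add: field_simps)
  qed (simp add: K.zero P.zero)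
  have coer: "(1/2) * (norm u)\<^sup>2 \<le> inner (T u) u" if u: "u \<in> S" for u
  proof -
    have "- inner (K u - P (K u)) u \<le> norm (K u - P (K u)) * norm u"
      using Cauchy_Schwarz_ineq2[of "K u - P (K u)" u] by linarith
    also have "\<dots> \<le> (norm u / 2) * norm u" by (intro mult_right_mono half u) auto
    finally show ?thesis
      by (simp add: T_def inner_add_left power2_eq_square flip: power2_norm_eq_inner)
  qed
  have TS: "T ` S \<subseteq> S"
    using KS oproj_mem[OF hN] spS
    by (auto simp: T_def P_def intro!: subspace_add[OF sub] subspace_diff[OF sub])
  have "S \<subseteq> span (N \<union> (\<lambda>x. x + K x) ` S)" (is "_ \<subseteq> span ?G")
  proof
    fix s assume "s \<in> S"
    then obtain x where x: "x \<in> S" "T x = s"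
      using coercive_surj[OF T S TS _ coer, of s] by auto
    have "s = (x + K x) - P (K x)" using x by (auto simp: T_def)
    moreover have "x + K x \<in> span ?G" using x by (intro span_base) auto
    moreover have "P (K x) \<in> span ?G"
      using oproj_mem[OF hN] span_mono[of N ?G] by (auto simp: P_def)
    ultimately show "s \<in> span ?G" by (auto intro: span_diff)
  qed
  then show ?thesis using N(1) by blast
qed

subsection \<open>Normalised operators between closed subspaces\<close>

lemma bop_add: "bop S T f \<Longrightarrow> x \<in> S \<Longrightarrow> y \<in> S \<Longrightarrow> f (x + y) = f x + f y"
  and bop_scaleR: "bop S T f \<Longrightarrow> x \<in> S \<Longrightarrow> f (c *\<^sub>R x) = c *\<^sub>R f x"
  and bop_outside: "bop S T f \<Longrightarrow> x \<notin> S \<Longrightarrow> f x = 0"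
  and bop_in: "bop S T f \<Longrightarrow> x \<in> S \<Longrightarrow> f x \<in> T"
  by (auto simp: bop_def)

lemma bop_mem: "bop S T f \<Longrightarrow> hilbert_sub T \<Longrightarrow> f x \<in> T"
  by (cases "x \<in> S") (auto simp: bop_in bop_outside hilbert_sub_def subspace_0)

lemma bop_zero: "bop S T f \<Longrightarrow> f 0 = 0"
  using bop_scaleR[of S T f 0 0] bop_outside[of S T f 0] by (cases "0 \<in> S") auto

lemma bop_diff:
  assumes f: "bop S T f" and S: "hilbert_sub S" and xy: "x \<in> S" "y \<in> S"
  shows "f (x - y) = f x - f y"
proof -
  have "x - y \<in> S" using S xy by (simp add: hilbert_sub_def subspace_diff)
  then have "f ((x - y) + y) = f (x - y) + f y" by (intro bop_add[OF f] xy)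
  then show ?thesis by simp
qed

text \<open>The bridge from operators on a subspace to the results about bounded linear maps on the
  ambient type.\<close>

lemma bounded_linear_bop_oproj:
  fixes S T :: "'a::{real_inner,complete_space} set"
  assumes f: "bop S T f" and S: "hilbert_sub S"
  shows "bounded_linear (\<lambda>x. f (oproj S x))"
proof -
  interpret P: bounded_linear "oproj S" by (rule bounded_linear_oproj[OF S])
  have "\<exists>K. \<forall>x\<in>S. norm (f x) \<le> K * norm x" using f by (simp add: bop_def)
  then obtain K where K: "\<And>x. x \<in> S \<Longrightarrow> norm (f x) \<le> K * norm x" by metis
  show ?thesis
  proof (rule bounded_linear_intro)
    show "f (oproj S (x + y)) = f (oproj S x) + f (oproj S y)" for x y
      by (simp add: P.add bop_add[OF f] oproj_mem[OF S])
    show "f (oproj S (c *\<^sub>R x)) = c *\<^sub>R f (oproj S x)" for c x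
      by (simp add: P.scaleR bop_scaleR[OF f] oproj_mem[OF S])
    \<comment> \<open>The bound \<open>K\<close> may be negative when \<open>S\<close> is trivial,
      hence the absolute value.\<close>
    show "norm (f (oproj S x)) \<le> norm x * \<bar>K\<bar>" for x
    proof -
      have "norm (f (oproj S x)) \<le> K * norm (oproj S x)" by (rule K[OF oproj_mem[OF S]])
      also have "\<dots> \<le> \<bar>K\<bar> * norm x"
        by (intro mult_mono norm_oproj_le[OF S]) auto
      finally show ?thesis by (simp add: mult.commute)
    qed
  qed
qed

lemma range_bop_oproj:
  fixes S :: "'a::{real_inner,complete_space} set"
  assumes S: "hilbert_sub S"
  shows "range (\<lambda>x. f (oproj S x)) = f ` S"
proof (intro set_eqI iffI)
  fix y assume "y \<in> f ` S"
  then obtain x where "x \<in> S" "y = f x" by blast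
  then have "y = f (oproj S x)" by (simp add: oproj_ident[OF S])
  then show "y \<in> range (\<lambda>x. f (oproj S x))" by blast
qed (use oproj_mem[OF S] in blast)

text \<open>The pairing extends to all ambient vectors because the projections are selfadjoint and
  fix the values of \<open>f\<close> and \<open>f'\<close>.\<close>

lemma is_adj_oproj:
  fixes S T :: "'a::{real_inner,complete_space} set"
  assumes f: "bop S T f" and f': "bop T S f'" and adj: "is_adj S T f f'"
    and S: "hilbert_sub S" and T: "hilbert_sub T"
  shows "inner (f (oproj S x)) y = inner x (f' (oproj T y))"
proof -
  have "inner (f (oproj S x)) y = inner (oproj T (f (oproj S x))) y"
    by (simp add: oproj_ident[OF T] bop_mem[OF f T])
  also have "\<dots> = inner (f (oproj S x)) (oproj T y)" by (rule oproj_selfadjoint[OF T])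
  also have "\<dots> = inner (oproj S x) (f' (oproj T y))"
    using adj oproj_mem[OF S] oproj_mem[OF T] by (simp add: is_adj_def)
  also have "\<dots> = inner x (oproj S (f' (oproj T y)))" by (rule oproj_selfadjoint[OF S])
  also have "\<dots> = inner x (f' (oproj T y))" by (simp add: oproj_ident[OF S] bop_mem[OF f' S])
  finally show ?thesis .
qed

lemma hilbert_sub_kernel:
  fixes S :: "'a::{real_inner,complete_space} set"
  assumes f: "bop S T f" and S: "hilbert_sub S"
  shows "hilbert_sub {x\<in>S. f x = 0}"
proof -
  interpret F: bounded_linear "\<lambda>x. f (oproj S x)" by (rule bounded_linear_bop_oproj[OF f S])
  have eq: "{x\<in>S. f x = 0} = S \<inter> {x. f (oproj S x) = 0}"
    using oproj_ident[OF S] by auto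
  have "subspace {x. f (oproj S x) = 0}"
    by (simp add: subspace_def F.zero F.add F.scaleR)
  moreover have "closed {x. f (oproj S x) = 0}"
    by (intro closed_Collect_eq F.continuous_on continuous_intros)
  ultimately show ?thesis
    unfolding eq using S by (simp add: hilbert_sub_def subspace_inter closed_Int)
qed

section \<open>Three-term Hilbert complexes and their Laplacian\<close>

locale short_complex =
  fixes E0 E1 E2 :: "'a::{real_inner,complete_space} set" and a b a' b' :: "'a \<Rightarrow> 'a"
  assumes E0: "hilbert_sub E0" and E1: "hilbert_sub E1" and E2: "hilbert_sub E2"
    and a: "bop E0 E1 a" and b: "bop E1 E2 b" and a': "bop E1 E0 a'" and b': "bop E2 E1 b'"
    and adja: "is_adj E0 E1 a a'" and adjb: "is_adj E1 E2 b b'"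
    and ba: "b (a x) = 0"
begin

definition lap :: "'a \<Rightarrow> 'a" where "lap u = a (a' u) + b' (b u)"

lemma lap_mem: "lap u \<in> E1"
  unfolding lap_def using E1 bop_mem[OF a E1] bop_mem[OF b' E1]
  by (simp add: hilbert_sub_def subspace_add)

lemma lap_diff:
  assumes "u \<in> E1" "w \<in> E1"
  shows "lap (u - w) = lap u - lap w"
  by (simp add: lap_def bop_diff[OF a' E1] bop_diff[OF b E1] bop_diff[OF a E0] bop_diff[OF b' E2]
      bop_mem[OF a' E0] bop_mem[OF b E2] assms)

lemma adja_eq: "x \<in> E0 \<Longrightarrow> y \<in> E1 \<Longrightarrow> inner (a x) y = inner x (a' y)"
  and adjb_eq: "x \<in> E1 \<Longrightarrow> y \<in> E2 \<Longrightarrow> inner (b x) y = inner x (b' y)"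
  using adja adjb by (auto simp: is_adj_def)

lemma inner_lap:
  assumes u: "u \<in> E1" and w: "w \<in> E1"
  shows "inner (lap u) w = inner (a' u) (a' w) + inner (b u) (b w)"
proof -
  have "inner (a (a' u)) w = inner (a' u) (a' w)" by (rule adja_eq[OF bop_in[OF a' u] w])
  moreover have "inner (b' (b u)) w = inner (b u) (b w)"
    using adjb_eq[OF w bop_in[OF b u]] by (simp add: inner_commute)
  ultimately show ?thesis by (simp add: lap_def inner_add_left)
qed

text \<open>Pairing \<open>lap u\<close> with \<open>u\<close> gives a sum of two squares.\<close>

lemma lap_eq_0_iff:
  assumes u: "u \<in> E1"
  shows "lap u = 0 \<longleftrightarrow> a' u = 0 \<and> b u = 0"
proof
  assume "lap u = 0"
  then have "inner (a' u) (a' u) + inner (b u) (b u) = 0" using inner_lap[OF u u] by simp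
  then show "a' u = 0 \<and> b u = 0" by (simp add: add_nonneg_eq_0_iff)
qed (simp add: lap_def bop_zero[OF a] bop_zero[OF b'])

lemma lap_selfadjoint:
  assumes "u \<in> E1" "w \<in> E1"
  shows "inner (lap u) w = inner u (lap w)"
  using inner_lap[OF assms] inner_lap[OF assms(2,1)] by (simp add: inner_commute)

lemma lap_image:
  assumes cla: "closed (a ` E0)" and clb: "closed (b ` E1)"
  shows "lap ` E1 = {v\<in>E1. \<forall>k\<in>E1. lap k = 0 \<longrightarrow> inner v k = 0}"
proof (intro set_eqI iffI)
  fix v assume "v \<in> lap ` E1"
  then show "v \<in> {v\<in>E1. \<forall>k\<in>E1. lap k = 0 \<longrightarrow> inner v k = 0}"
    by (auto simp: lap_mem lap_selfadjoint)
next
  fix v assume v: "v \<in> {v\<in>E1. \<forall>k\<in>E1. lap k = 0 \<longrightarrow> inner v k = 0}"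
  have "\<exists>u. a (oproj E0 (a' (oproj E1 u))) + b' (oproj E2 (b (oproj E1 u))) = v"
  proof (rule hodge_surj[where a = "\<lambda>x. a (oproj E0 x)" and b = "\<lambda>x. b (oproj E1 x)"
        and a' = "\<lambda>x. a' (oproj E1 x)" and b' = "\<lambda>x. b' (oproj E2 x)"])
    show "bounded_linear (\<lambda>x. a (oproj E0 x))" by (rule bounded_linear_bop_oproj[OF a E0])
    show "bounded_linear (\<lambda>x. b (oproj E1 x))" by (rule bounded_linear_bop_oproj[OF b E1])
    show "bounded_linear (\<lambda>x. a' (oproj E1 x))" by (rule bounded_linear_bop_oproj[OF a' E1])
    show "bounded_linear (\<lambda>x. b' (oproj E2 x))" by (rule bounded_linear_bop_oproj[OF b' E2])
    show "inner (a (oproj E0 x)) y = inner x (a' (oproj E1 y))" for x y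
      by (rule is_adj_oproj[OF a a' adja E0 E1])
    show "inner (b (oproj E1 x)) y = inner x (b' (oproj E2 y))" for x y
      by (rule is_adj_oproj[OF b b' adjb E1 E2])
    show "b (oproj E1 (a (oproj E0 x))) = 0" for x
      by (simp add: oproj_ident[OF E1] bop_mem[OF a E1] ba)
    show "closed (range (\<lambda>x. a (oproj E0 x)))" using cla by (simp add: range_bop_oproj[OF E0])
    show "closed (range (\<lambda>x. b (oproj E1 x)))" using clb by (simp add: range_bop_oproj[OF E1])
    \<comment> \<open>The extended operators also vanish on the orthogonal complement of
      \<open>E1\<close>. As \<open>v\<close> lies in \<open>E1\<close>, only the component of
      \<open>k\<close> in \<open>E1\<close> matters, and that component is harmonic.\<close>
    show "inner v k = 0" if "a' (oproj E1 k) = 0" "b (oproj E1 k) = 0" for k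
    proof -
      have "inner v k = inner (oproj E1 v) k" using v by (simp add: oproj_ident[OF E1])
      also have "\<dots> = inner v (oproj E1 k)" by (rule oproj_selfadjoint[OF E1])
      also have "\<dots> = 0" using v that oproj_mem[OF E1] by (simp add: lap_eq_0_iff)
      finally show ?thesis .
    qed
  qed
  then obtain u where "lap (oproj E1 u) = v"
    by (auto simp: lap_def oproj_ident[OF E0] oproj_ident[OF E2] bop_mem[OF a' E0] bop_mem[OF b E2])
  then show "v \<in> lap ` E1" using oproj_mem[OF E1] by blast
qed

text \<open>A harmonic \<open>u\<close> is some \<open>a w\<close> by exactness and satisfies
  \<open>a' u = 0\<close>, so it is orthogonal to itself; with trivial kernel,
  \<open>lap_image\<close> becomes all of \<open>E1\<close>. Exactness at \<open>E1\<close> closes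
  only the range of \<open>a\<close>; closedness of the range of \<open>b\<close> is assumed because
  it comes from the next position.\<close>

lemma exact_imp_bij_lap:
  assumes exact: "{u\<in>E1. b u = 0} = a ` E0" and clb: "closed (b ` E1)"
  shows "bij_betw lap E1 E1"
proof -
  have ker: "u = 0" if u: "u \<in> E1" "lap u = 0" for u
  proof -
    have "a' u = 0" "b u = 0" using u(2) unfolding lap_eq_0_iff[OF u(1)] by simp_all
    then have "u \<in> a ` E0" using u(1) by (simp flip: exact)
    then obtain w where w: "w \<in> E0" "u = a w" by blast
    have "inner (a w) u = 0" by (simp add: adja_eq[OF w(1) u(1)] \<open>a' u = 0\<close>)
    then have "inner u u = 0" by (simp only: w(2))
    then show ?thesis by simp
  qed
  have "closed {u\<in>E1. b u = 0}" using hilbert_sub_kernel[OF b E1] by (simp add: hilbert_sub_def)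
  then have "closed (a ` E0)" by (simp only: exact)
  then have "lap ` E1 = {v\<in>E1. \<forall>k\<in>E1. lap k = 0 \<longrightarrow> inner v k = 0}" by (rule lap_image[OF _ clb])
  also have "\<dots> = E1"
  proof -
    have "inner v k = 0" if "k \<in> E1" "lap k = 0" for v k using ker[OF that] by simp
    then show ?thesis by blast
  qed
  finally have "lap ` E1 = E1" .
  moreover have "inj_on lap E1"
  proof (rule inj_onI)
    fix u w assume uw: "u \<in> E1" "w \<in> E1" "lap u = lap w"
    then have "u - w \<in> E1" using E1 by (simp add: hilbert_sub_def subspace_diff)
    then have "u - w = 0" by (rule ker) (simp add: lap_diff uw)
    then show "u = w" by simp
  qed
  ultimately show ?thesis by (simp add: bij_betw_def)
qed

lemma bij_lap_imp_exact:
  assumes "bij_betw lap E1 E1"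
  shows "{u\<in>E1. b u = 0} = a ` E0"
proof (intro set_eqI iffI)
  fix u assume u: "u \<in> {u\<in>E1. b u = 0}"
  then have "u \<in> lap ` E1" using assms by (simp add: bij_betw_def)
  then obtain v where v: "v \<in> E1" "u = lap v" by blast
  \<comment> \<open>Since \<open>b\<close> kills the range of \<open>a\<close>,
    \<open>b w = b u = 0\<close>; and \<open>w\<close> lies in the range of \<open>b'\<close>, so
    pairing it with itself gives \<open>inner (b w) (b v) = 0\<close>.\<close>
  define w where "w = b' (b v)"
  have w: "w \<in> E1" unfolding w_def by (rule bop_mem[OF b' E1])
  have "b (a (a' v) + w) = b w"
    by (simp add: bop_add[OF b bop_mem[OF a E1] w] ba)
  then have "b w = 0" using u v by (simp add: lap_def w_def)
  then have "inner w w = 0"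
    using adjb_eq[OF w bop_mem[OF b E2], of v] by (simp add: w_def)
  then have "u = a (a' v)" using v by (simp add: lap_def w_def)
  then show "u \<in> a ` E0" using bop_mem[OF a' E0] by blast
qed (auto simp: ba bop_mem[OF a E1])

lemma finite_cohomology_imp_closed_range:
  assumes F: "finite F" and ker: "{u\<in>E1. b u = 0} \<subseteq> span (F \<union> a ` E0)"
  shows "closed (a ` E0)"
proof -
  have "closed (range (\<lambda>x. a (oproj E0 x)))"
  proof (rule closed_range_finite_codim[OF _ _ _ F])
    show "bounded_linear (\<lambda>x. a (oproj E0 x))" by (rule bounded_linear_bop_oproj[OF a E0])
    show "hilbert_sub {u\<in>E1. b u = 0}" by (rule hilbert_sub_kernel[OF b E1])
    show "range (\<lambda>x. a (oproj E0 x)) \<subseteq> {u\<in>E1. b u = 0}"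
      using bop_mem[OF a E1] ba by auto
    show "{u\<in>E1. b u = 0} \<subseteq> span (F \<union> range (\<lambda>x. a (oproj E0 x)))"
      using ker by (simp add: range_bop_oproj[OF E0])
  qed
  then show ?thesis by (simp add: range_bop_oproj[OF E0])
qed

lemma finite_cohomology_imp_fredholm_lap:
  assumes F: "finite F" and ker: "{u\<in>E1. b u = 0} \<subseteq> span (F \<union> a ` E0)"
    and clb: "closed (b ` E1)"
  shows "fredholm_op E1 E1 lap"
proof -
  have cla: "closed (a ` E0)" by (rule finite_cohomology_imp_closed_range[OF F ker])
  interpret aP: bounded_linear "\<lambda>x. a (oproj E0 x)" by (rule bounded_linear_bop_oproj[OF a E0])
  have subR: "subspace (a ` E0)"
    using linear_subspace_image[OF aP.linear subspace_UNIV] by (simp add: range_bop_oproj[OF E0])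
  then have hR: "hilbert_sub (a ` E0)" using cla by (simp add: hilbert_sub_def)
  interpret P: bounded_linear "oproj (a ` E0)" by (rule bounded_linear_oproj[OF hR])
  define Q where "Q x = x - oproj (a ` E0) x" for x
  have Q: "linear Q"
    unfolding Q_def by (intro linear_compose_sub linear_ident P.linear)
  define N where "N = {x\<in>E1. lap x = 0}"
  have N_eq: "N = {x\<in>E1. a' x = 0} \<inter> {x\<in>E1. b x = 0}" by (auto simp: N_def lap_eq_0_iff)
  then have hN: "hilbert_sub N"
    using hilbert_sub_kernel[OF a' E1] hilbert_sub_kernel[OF b E1]
    by (simp add: hilbert_sub_def subspace_inter closed_Int)
  have NF: "N \<subseteq> span (Q ` F)"
  proof
    fix v assume "v \<in> N"
    then have v: "v \<in> E1" "a' v = 0" "b v = 0" by (auto simp: N_eq)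
    then have "v \<in> span (F \<union> a ` E0)" using ker by blast
    then obtain f r where fr: "v = f + r" "f \<in> span F" "r \<in> span (a ` E0)"
      unfolding span_Un by blast
    have "span (a ` E0) = a ` E0" using subR by (simp only: span_eq_iff)
    then have "r \<in> a ` E0" using fr(3) by blast
    then have "Q r = 0" by (simp add: Q_def oproj_ident[OF hR])
    have "oproj (a ` E0) v = 0"
    proof (rule oproj_eqI[OF hR subspace_0[OF subR]])
      fix k assume "k \<in> a ` E0"
      then obtain w where w: "w \<in> E0" "k = a w" by blast
      then have "inner k v = 0" using adja_eq[OF w(1) v(1)] v(2) by simp
      then show "inner (v - 0) k = 0" by (simp add: inner_commute)
    qed
    then have "v = Q v" by (simp add: Q_def)
    also have "\<dots> = Q f" using \<open>Q r = 0\<close> by (simp add: fr(1) linear_add[OF Q])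
    finally show "v \<in> span (Q ` F)" using fr(2) by (simp add: linear_span_image[OF Q])
  qed
  have im: "lap ` E1 = E1 \<inter> {v. \<forall>k\<in>N. inner v k = 0}"
    unfolding lap_image[OF cla clb] by (auto simp: N_def)
  have "closed (lap ` E1)"
    unfolding im using E1 hilbert_sub_orth[of N] by (simp add: hilbert_sub_def closed_Int)
  moreover have "E1 \<subseteq> span (Q ` F \<union> lap ` E1)"
  proof
    fix y assume y: "y \<in> E1"
    have p: "oproj N y \<in> N" by (rule oproj_mem[OF hN])
    then have "y - oproj N y \<in> E1"
      using E1 y by (simp add: N_def hilbert_sub_def subspace_diff)
    then have "y - oproj N y \<in> lap ` E1" using oproj_orth[OF hN] by (simp add: im)
    then have "y - oproj N y \<in> span (Q ` F \<union> lap ` E1)" by (intro span_base) simp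
    moreover have "oproj N y \<in> span (Q ` F \<union> lap ` E1)"
      by (rule subsetD[OF span_mono subsetD[OF NF p]]) simp
    ultimately have "(y - oproj N y) + oproj N y \<in> span (Q ` F \<union> lap ` E1)" by (rule span_add)
    then show "y \<in> span (Q ` F \<union> lap ` E1)" by simp
  qed
  moreover have "finite (Q ` F)" using F by simp
  moreover have "{x\<in>E1. lap x = 0} \<subseteq> span (Q ` F)" using NF by (simp only: N_def)
  ultimately show ?thesis unfolding fredholm_op_def by (intro conjI exI[of _ "Q ` F"])
qed

end

lemma homotopy_imp_finite_cohomology:
  fixes E1 :: "'a::{real_inner,complete_space} set"
  assumes E1: "hilbert_sub E1"
    and a: "bop E0 E1 a" and b: "bop E1 E2 b" and s: "bop E1 E0 s" and t: "bop E2 E1 t"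
    and ba: "\<And>x. b (a x) = 0"
    and K: "bop E1 E1 K" "compact_op E1 K" "\<And>y. y \<in> E1 \<Longrightarrow> a (s y) + t (b y) - y = K y"
  shows "\<exists>F. finite F \<and> {u\<in>E1. b u = 0} \<subseteq> span (F \<union> a ` E0)"
proof -
  define S where "S = {u\<in>E1. b u = 0}"
  have S: "hilbert_sub S" unfolding S_def by (rule hilbert_sub_kernel[OF b E1])
  define K' where "K' x = K (oproj E1 x)" for x
  have K': "bounded_linear K'" unfolding K'_def by (rule bounded_linear_bop_oproj[OF K(1) E1])
  have K'S: "x + K' x = a (s x)" if "x \<in> S" for x
    using K(3)[of x] that by (simp add: K'_def S_def oproj_ident[OF E1] bop_zero[OF t] algebra_simps)
  \<comment> \<open>On the kernel \<open>S\<close> of \<open>b\<close>, the compact term equals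
    \<open>a (s x) - x\<close>, and both summands lie in \<open>S\<close>.\<close>
  have sub: "K' ` S \<subseteq> S"
  proof
    fix y assume "y \<in> K' ` S"
    then obtain x where x: "x \<in> S" "y = K' x" by blast
    have "a (s x) \<in> S" by (simp add: S_def ba bop_mem[OF a E1])
    then have "a (s x) - x \<in> S" using x S by (simp add: hilbert_sub_def subspace_diff)
    moreover have "y = a (s x) - x" using K'S[OF x(1)] x(2) by (simp add: eq_diff_eq add.commute)
    ultimately show "y \<in> S" by simp
  qed
  have cpt: "compact (closure (K' ` (S \<inter> cball 0 1)))"
  proof -
    have "K' ` (S \<inter> cball 0 1) \<subseteq> K ` (E1 \<inter> cball 0 1)"
      by (auto simp: K'_def S_def oproj_ident[OF E1])
    then have "closure (K' ` (S \<inter> cball 0 1)) \<subseteq> closure (K ` (E1 \<inter> cball 0 1))"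
      by (rule closure_mono)
    moreover have "compact (closure (K ` (E1 \<inter> cball 0 1)))" using K(2) by (simp add: compact_op_def)
    ultimately show ?thesis 
      using compact_Int_closed[OF _ closed_closure] by (metis inf.absorb2)
  qed
  obtain N where N: "finite N" "S \<subseteq> span (N \<union> (\<lambda>x. x + K' x) ` S)"
    using finite_codim_id_plus_compact[OF K' S sub cpt] by blast
  have "(\<lambda>x. x + K' x) ` S \<subseteq> a ` E0"
  proof
    fix y assume "y \<in> (\<lambda>x. x + K' x) ` S"
    then obtain x where "x \<in> S" "y = a (s x)" using K'S by blast
    then show "y \<in> a ` E0" using bop_in[OF s] by (auto simp: S_def)
  qed
  then have "span (N \<union> (\<lambda>x. x + K' x) ` S) \<subseteq> span (N \<union> a ` E0)" by (intro span_mono) blast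
  then show ?thesis using N by (auto simp: S_def)
qed

subsection \<open>Calculus modulo smoothing operators\<close>

locale op_algebra =
  fixes H :: "'g \<Rightarrow> 'h::{real_inner,complete_space} set"
    and L0 Linf :: "'g \<Rightarrow> 'g \<Rightarrow> ('h \<Rightarrow> 'h) set"
  assumes alg: "gen_op_alg H L0 Linf"
begin

lemma
  shows H: "hilbert_sub (H g)"
    and L0_bop: "A \<in> L0 g0 g1 \<Longrightarrow> bop (H g0) (H g1) A"
    and Linf_L0: "A \<in> Linf g0 g1 \<Longrightarrow> A \<in> L0 g0 g1"
    and zero_Linf: "(\<lambda>_. 0) \<in> Linf g0 g1"
    and Linf_compact: "A \<in> Linf g0 g1 \<Longrightarrow> compact_op (H g0) A"
    and idop_L0: "idop (H g) \<in> L0 g g"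
  using alg by (simp_all add: gen_op_alg_def subset_iff)

lemma
  shows L0_add: "A \<in> L0 g0 g1 \<Longrightarrow> B \<in> L0 g0 g1 \<Longrightarrow> (\<lambda>y. A y + B y) \<in> L0 g0 g1"
    and Linf_add: "A \<in> Linf g0 g1 \<Longrightarrow> B \<in> Linf g0 g1 \<Longrightarrow> (\<lambda>y. A y + B y) \<in> Linf g0 g1"
    and L0_scaleR: "A \<in> L0 g0 g1 \<Longrightarrow> (\<lambda>y. c *\<^sub>R A y) \<in> L0 g0 g1"
    and Linf_scaleR: "A \<in> Linf g0 g1 \<Longrightarrow> (\<lambda>y. c *\<^sub>R A y) \<in> Linf g0 g1"
    and L0_o: "A \<in> L0 g0 g1 \<Longrightarrow> B \<in> L0 g1 g2 \<Longrightarrow> B \<circ> A \<in> L0 g0 g2"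
    and Linf_o_left: "A \<in> Linf g0 g1 \<Longrightarrow> B \<in> L0 g1 g2 \<Longrightarrow> B \<circ> A \<in> Linf g0 g2"
    and Linf_o_right: "A \<in> L0 g0 g1 \<Longrightarrow> B \<in> Linf g1 g2 \<Longrightarrow> B \<circ> A \<in> Linf g0 g2"
    and ex_adjoint: "A \<in> L0 g0 g1 \<Longrightarrow> \<exists>A'\<in>L0 g1 g0. is_adj (H g0) (H g1) A A'"
proof -
  have 1: "\<forall>g0 g1. \<forall>A\<in>L0 g0 g1. \<forall>B\<in>L0 g0 g1. (\<lambda>y. A y + B y) \<in> L0 g0 g1"
    and 2: "\<forall>g0 g1. \<forall>A\<in>Linf g0 g1. \<forall>B\<in>Linf g0 g1. (\<lambda>y. A y + B y) \<in> Linf g0 g1"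
    and 3: "\<forall>g0 g1 c. \<forall>A\<in>L0 g0 g1. (\<lambda>y. c *\<^sub>R A y) \<in> L0 g0 g1"
    and 4: "\<forall>g0 g1 c. \<forall>A\<in>Linf g0 g1. (\<lambda>y. c *\<^sub>R A y) \<in> Linf g0 g1"
    and 5: "\<forall>g0 g1 g2. \<forall>A\<in>L0 g0 g1. \<forall>B\<in>L0 g1 g2. B \<circ> A \<in> L0 g0 g2"
    and 6: "\<forall>g0 g1 g2. \<forall>A\<in>Linf g0 g1. \<forall>B\<in>L0 g1 g2. B \<circ> A \<in> Linf g0 g2"
    and 7: "\<forall>g0 g1 g2. \<forall>A\<in>L0 g0 g1. \<forall>B\<in>Linf g1 g2. B \<circ> A \<in> Linf g0 g2"
    and 8: "\<forall>g0 g1. \<forall>A\<in>L0 g0 g1. \<exists>A'\<in>L0 g1 g0. is_adj (H g0) (H g1) A A'"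
    using alg unfolding gen_op_alg_def by - (elim conjE, assumption)+
  show "A \<in> L0 g0 g1 \<Longrightarrow> B \<in> L0 g0 g1 \<Longrightarrow> (\<lambda>y. A y + B y) \<in> L0 g0 g1"
    by (rule 1[rule_format])
  show "A \<in> Linf g0 g1 \<Longrightarrow> B \<in> Linf g0 g1 \<Longrightarrow> (\<lambda>y. A y + B y) \<in> Linf g0 g1"
    by (rule 2[rule_format])
  show "A \<in> L0 g0 g1 \<Longrightarrow> (\<lambda>y. c *\<^sub>R A y) \<in> L0 g0 g1"
    by (rule 3[rule_format])
  show "A \<in> Linf g0 g1 \<Longrightarrow> (\<lambda>y. c *\<^sub>R A y) \<in> Linf g0 g1"
    by (rule 4[rule_format])
  show "A \<in> L0 g0 g1 \<Longrightarrow> B \<in> L0 g1 g2 \<Longrightarrow> B \<circ> A \<in> L0 g0 g2"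
    by (rule 5[rule_format])
  show "A \<in> Linf g0 g1 \<Longrightarrow> B \<in> L0 g1 g2 \<Longrightarrow> B \<circ> A \<in> Linf g0 g2"
    by (rule 6[rule_format])
  show "A \<in> L0 g0 g1 \<Longrightarrow> B \<in> Linf g1 g2 \<Longrightarrow> B \<circ> A \<in> Linf g0 g2"
    by (rule 7[rule_format])
  show "A \<in> L0 g0 g1 \<Longrightarrow> \<exists>A'\<in>L0 g1 g0. is_adj (H g0) (H g1) A A'"
    by (rule 8[rule_format])
qed

lemmas L0_comp = L0_o[unfolded comp_def]
lemmas Linf_comp_left = Linf_o_left[unfolded comp_def]
lemmas Linf_comp_right = Linf_o_right[unfolded comp_def]

lemma L0_diff: "A \<in> L0 g0 g1 \<Longrightarrow> B \<in> L0 g0 g1 \<Longrightarrow> (\<lambda>y. A y - B y) \<in> L0 g0 g1"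
  using L0_add[OF _ L0_scaleR[of B g0 g1 "-1"]] by simp

lemma L0_mem: "A \<in> L0 g0 g1 \<Longrightarrow> A y \<in> H g1"
  by (rule bop_mem[OF L0_bop H])

lemma idop_L0_apply: "A \<in> L0 g0 g1 \<Longrightarrow> idop (H g1) (A y) = A y"
  by (simp add: idop_def L0_mem)

lemma L0_apply_idop: "A \<in> L0 g0 g1 \<Longrightarrow> A (idop (H g0) y) = A y"
  using bop_zero[OF L0_bop, of A g0 g1] bop_outside[OF L0_bop, of A g0 g1 y] by (simp add: idop_def)

lemma L0_apply_zero: "A \<in> L0 g0 g1 \<Longrightarrow> A 0 = 0"
  by (rule bop_zero[OF L0_bop])

lemma L0_apply_add:
  "A \<in> L0 g0 g1 \<Longrightarrow> x \<in> H g0 \<Longrightarrow> y \<in> H g0 \<Longrightarrow> A (x + y) = A x + A y"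
  by (rule bop_add[OF L0_bop])

lemma L0_apply_diff:
  "A \<in> L0 g0 g1 \<Longrightarrow> x \<in> H g0 \<Longrightarrow> y \<in> H g0 \<Longrightarrow> A (x - y) = A x - A y"
  by (rule bop_diff[OF L0_bop H])

lemma adjop:
  assumes "A \<in> L0 g0 g1"
  shows adjop_L0: "adjop H L0 g0 g1 A \<in> L0 g1 g0"
    and adjop_is_adj: "is_adj (H g0) (H g1) A (adjop H L0 g0 g1 A)"
proof -
  have "\<exists>A'. A' \<in> L0 g1 g0 \<and> is_adj (H g0) (H g1) A A'"
    using ex_adjoint[OF assms] by blast
  from someI_ex[OF this]
  show "adjop H L0 g0 g1 A \<in> L0 g1 g0" "is_adj (H g0) (H g1) A (adjop H L0 g0 g1 A)"
    unfolding adjop_def by blast+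
qed

text \<open>Equality in the quotient by the smoothing operators, so that parametrices become
  inverses and can be handled by chains of congruences.\<close>

definition cong_smoothing :: "'g \<Rightarrow> 'g \<Rightarrow> ('h \<Rightarrow> 'h) \<Rightarrow> ('h \<Rightarrow> 'h) \<Rightarrow> bool" where
  "cong_smoothing g0 g1 A B \<longleftrightarrow> (\<lambda>y. A y - B y) \<in> Linf g0 g1"

lemma cong_smoothing_sym: "cong_smoothing g0 g1 A B \<Longrightarrow> cong_smoothing g0 g1 B A"
  unfolding cong_smoothing_def using Linf_scaleR[of "\<lambda>y. A y - B y" g0 g1 "-1"] by simp

lemma cong_smoothing_refl: "cong_smoothing g0 g1 A A"
  by (simp add: cong_smoothing_def zero_Linf)

lemma cong_smoothing_trans:
  "cong_smoothing g0 g1 A B \<Longrightarrow> cong_smoothing g0 g1 B C \<Longrightarrow> cong_smoothing g0 g1 A C"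
  unfolding cong_smoothing_def
  using Linf_add[of "\<lambda>y. A y - B y" g0 g1 "\<lambda>y. B y - C y"] by simp

lemma cong_smoothing_add:
  "cong_smoothing g0 g1 A B \<Longrightarrow> cong_smoothing g0 g1 C D
    \<Longrightarrow> cong_smoothing g0 g1 (\<lambda>y. A y + C y) (\<lambda>y. B y + D y)"
  unfolding cong_smoothing_def
  using Linf_add[of "\<lambda>y. A y - B y" g0 g1 "\<lambda>y. C y - D y"] by (simp add: algebra_simps)

lemma cong_smoothing_comp_right:
  "cong_smoothing g1 g2 A B \<Longrightarrow> C \<in> L0 g0 g1 \<Longrightarrow> cong_smoothing g0 g2 (\<lambda>y. A (C y)) (\<lambda>y. B (C y))"
  unfolding cong_smoothing_def by (rule Linf_comp_right)

text \<open>\<open>C\<close> is additive only on \<open>H g1\<close>, hence the membership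
  conditions; composition on the right is pointwise and needs none.\<close>

lemma cong_smoothing_comp_left:
  assumes AB: "cong_smoothing g0 g1 A B" and mem: "\<And>y. A y \<in> H g1" "\<And>y. B y \<in> H g1"
    and C: "C \<in> L0 g1 g2"
  shows "cong_smoothing g0 g2 (\<lambda>y. C (A y)) (\<lambda>y. C (B y))"
  using Linf_comp_left[OF AB[unfolded cong_smoothing_def] C]
  by (simp add: cong_smoothing_def L0_apply_diff[OF C] mem)

lemma has_parametrix_iff:
  "has_parametrix H L0 Linf g0 g1 A \<longleftrightarrow>
    (\<exists>B\<in>L0 g1 g0. cong_smoothing g1 g1 (\<lambda>y. A (B y)) (idop (H g1)) \<and>
      cong_smoothing g0 g0 (\<lambda>y. B (A y)) (idop (H g0)))"
  by (simp add: has_parametrix_def cong_smoothing_def)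

text \<open>Modulo smoothing, A D0 = D1 P1 A D0 = D1 A P0 D0 = D1 A. So a right parametrix
  \<open>D0\<close> and a left parametrix \<open>D1\<close> are enough.\<close>

lemma parametrix_intertwine:
  assumes A: "A \<in> L0 g0 g1" and P: "P0 \<in> L0 g0 g0" "P1 \<in> L0 g1 g1"
    and D: "D0 \<in> L0 g0 g0" "D1 \<in> L0 g1 g1"
    and AP: "\<And>y. A (P0 y) = P1 (A y)"
    and D0: "cong_smoothing g0 g0 (\<lambda>y. P0 (D0 y)) (idop (H g0))"
    and D1: "cong_smoothing g1 g1 (\<lambda>y. D1 (P1 y)) (idop (H g1))"
  shows "cong_smoothing g0 g1 (\<lambda>y. A (D0 y)) (\<lambda>y. D1 (A y))"
proof -
  have AD: "(\<lambda>y. A (D0 y)) \<in> L0 g0 g1" by (rule L0_comp[OF D(1) A])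
  have DA: "(\<lambda>y. D1 (A y)) \<in> L0 g0 g1" by (rule L0_comp[OF A D(2)])
  have "cong_smoothing g0 g1 (\<lambda>y. D1 (P1 (A (D0 y)))) (\<lambda>y. idop (H g1) (A (D0 y)))"
    by (rule cong_smoothing_comp_right[OF D1 AD])
  then have 1: "cong_smoothing g0 g1 (\<lambda>y. A (D0 y)) (\<lambda>y. D1 (P1 (A (D0 y))))"
    by (simp add: idop_L0_apply[OF A] cong_smoothing_sym)
  have "cong_smoothing g0 g1 (\<lambda>y. D1 (A (P0 (D0 y)))) (\<lambda>y. D1 (A (idop (H g0) y)))"
    by (rule cong_smoothing_comp_left[OF D0 _ _ DA])
      (rule L0_mem[OF P(1)], rule L0_mem[OF idop_L0])
  then have 2: "cong_smoothing g0 g1 (\<lambda>y. D1 (P1 (A (D0 y)))) (\<lambda>y. D1 (A y))"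
    by (simp add: AP L0_apply_idop[OF A])
  show ?thesis by (rule cong_smoothing_trans[OF 1 2])
qed

end

section \<open>Complexes of operators in the algebra\<close>

locale alg_complex = op_algebra H L0 Linf
  for H :: "'g \<Rightarrow> 'h::{real_inner,complete_space} set"
    and L0 Linf :: "'g \<Rightarrow> 'g \<Rightarrow> ('h \<Rightarrow> 'h) set" +
  fixes g :: "int \<Rightarrow> 'g" and A :: "int \<Rightarrow> 'h \<Rightarrow> 'h"
  assumes cx: "op_complex L0 g A"
begin

definition As :: "int \<Rightarrow> 'h \<Rightarrow> 'h" where
  "As j = adjop H L0 (g j) (g (j + 1)) (A j)"

abbreviation Lap :: "int \<Rightarrow> 'h \<Rightarrow> 'h" where
  "Lap \<equiv> laplacian H L0 g A"

lemma A_L0: "A j \<in> L0 (g j) (g (j + 1))"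
  using cx by (simp add: op_complex_def)

lemma As_L0: "As j \<in> L0 (g (j + 1)) (g j)"
  unfolding As_def by (rule adjop_L0[OF A_L0])

lemma As_is_adj: "is_adj (H (g j)) (H (g (j + 1))) (A j) (As j)"
  unfolding As_def by (rule adjop_is_adj[OF A_L0])

text \<open>Normalises the weight \<open>g (j - 1 + 1)\<close> to \<open>g j\<close> once and for
  all.\<close>

lemma A_prev_L0: "A (j - 1) \<in> L0 (g (j - 1)) (g j)"
  and As_prev_L0: "As (j - 1) \<in> L0 (g j) (g (j - 1))"
  using A_L0[of "j - 1"] As_L0[of "j - 1"] by simp_all

lemma A_A: "A (j + 1) (A j y) = 0"
  using cx by (simp add: op_complex_def fun_eq_iff)

lemma A_A_prev: "A j (A (j - 1) y) = 0"
  using A_A[of "j - 1" y] by simp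

lemma As_adj: "x \<in> H (g j) \<Longrightarrow> y \<in> H (g (j + 1)) \<Longrightarrow> inner (A j x) y = inner x (As j y)"
  using As_is_adj by (simp add: is_adj_def)

lemma Lap_eq: "Lap j y = A (j - 1) (As (j - 1) y) + As j (A j y)"
  by (simp add: laplacian_def As_def)

lemma Lap_L0: "Lap j \<in> L0 (g j) (g j)"
  unfolding Lap_eq[abs_def]
  by (rule L0_add[OF L0_comp[OF As_prev_L0 A_prev_L0] L0_comp[OF A_L0 As_L0]])

lemma short_complex_Lap:
  "short_complex (H (g (j - 1))) (H (g j)) (H (g (j + 1))) (A (j - 1)) (A j) (As (j - 1)) (As j)"
proof
  show "is_adj (H (g (j - 1))) (H (g j)) (A (j - 1)) (As (j - 1))"
    using As_is_adj[of "j - 1"] by simp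
qed (rule H L0_bop[OF A_prev_L0] L0_bop[OF A_L0] L0_bop[OF As_prev_L0] L0_bop[OF As_L0]
    As_is_adj A_A_prev)+

lemma lap_eq_Lap: "short_complex.lap (A (j - 1)) (A j) (As (j - 1)) (As j) = Lap j"
  by (rule ext) (simp add: short_complex.lap_def[OF short_complex_Lap] Lap_eq)

lemma Lap_eq_0_iff:
  "u \<in> H (g j) \<Longrightarrow> Lap j u = 0 \<longleftrightarrow> As (j - 1) u = 0 \<and> A j u = 0"
  using short_complex.lap_eq_0_iff[OF short_complex_Lap, of u j] by (simp add: lap_eq_Lap)

lemma Lap_selfadjoint: "is_adj (H (g j)) (H (g j)) (Lap j) (Lap j)"
  using short_complex.lap_selfadjoint[OF short_complex_Lap, of _ j]
  by (simp add: lap_eq_Lap is_adj_def)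

lemma As_As: "As j (As (j + 1) y) = 0"
proof (cases "y \<in> H (g (j + 1 + 1))")
  case True
  define w where "w = As j (As (j + 1) y)"
  have w: "w \<in> H (g j)" unfolding w_def by (rule L0_mem[OF As_L0])
  have "inner w w = inner (A j w) (As (j + 1) y)"
    using As_adj[OF w L0_mem[OF As_L0, of "j + 1" y]] by (simp add: w_def)
  also have "\<dots> = inner (A (j + 1) (A j w)) y"
    using As_adj[OF L0_mem[OF A_L0, of j w] True] by simp
  also have "\<dots> = 0" by (simp add: A_A)
  finally show ?thesis by (simp add: w_def)
next
  case False
  then have "As (j + 1) y = 0" using bop_outside[OF L0_bop[OF As_L0]] by blast
  then show ?thesis by (simp add: L0_apply_zero[OF As_L0])
qed

lemma A_Lap: "A (j - 1) (Lap (j - 1) y) = Lap j (A (j - 1) y)"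
proof -
  let ?i = "j - 1"
  have "A ?i (Lap ?i y) = A ?i (A (?i - 1) (As (?i - 1) y)) + A ?i (As ?i (A ?i y))"
    unfolding Lap_eq
    by (rule L0_apply_add[OF A_L0 L0_mem[OF A_prev_L0] L0_mem[OF As_L0]])
  also have "\<dots> = A ?i (As ?i (A ?i y))" by (simp only: A_A_prev add_0)
  also have "\<dots> = Lap j (A ?i y)" by (simp add: Lap_eq A_A_prev L0_apply_zero[OF As_L0])
  finally show ?thesis .
qed

text \<open>By intertwining, D_{j-1} may be moved past A_{j-1} and becomes D_j modulo smoothing. The
  two terms of the homotopy identity then combine to D_j applied to the Laplacian at j, which is the
  identity modulo smoothing.\<close>

lemma complex_parametrix_of_Lap:
  assumes D: "\<And>j. D j \<in> L0 (g j) (g j)"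
    and LD: "\<And>j. cong_smoothing (g j) (g j) (\<lambda>y. Lap j (D j y)) (idop (H (g j)))"
    and DL: "\<And>j. cong_smoothing (g j) (g j) (\<lambda>y. D j (Lap j y)) (idop (H (g j)))"
  shows "complex_parametrix H L0 Linf g A (\<lambda>j y. D j (As j y))"
  unfolding complex_parametrix_def
proof (intro allI conjI)
  fix j
  show "(\<lambda>y. D j (As j y)) \<in> L0 (g (j + 1)) (g j)" by (rule L0_comp[OF As_L0 D])
  have "cong_smoothing (g (j - 1)) (g j) (\<lambda>y. A (j - 1) (D (j - 1) y)) (\<lambda>y. D j (A (j - 1) y))"
    by (rule parametrix_intertwine[OF A_prev_L0 Lap_L0[of "j - 1"] Lap_L0[of j] D[of "j - 1"]
          D[of j] A_Lap LD DL])
  then have "cong_smoothing (g j) (g j)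
      (\<lambda>y. A (j - 1) (D (j - 1) (As (j - 1) y))) (\<lambda>y. D j (A (j - 1) (As (j - 1) y)))"
    by (rule cong_smoothing_comp_right[OF _ As_prev_L0])
  from cong_smoothing_add[OF this cong_smoothing_refl[of _ _ "\<lambda>y. D j (As j (A j y))"]]
  have "cong_smoothing (g j) (g j)
      (\<lambda>y. A (j - 1) (D (j - 1) (As (j - 1) y)) + D j (As j (A j y))) (\<lambda>y. D j (Lap j y))"
    by (simp add: Lap_eq L0_apply_add[OF D L0_mem[OF A_prev_L0] L0_mem[OF As_L0]])
  from cong_smoothing_trans[OF this DL]
  show "(\<lambda>y. A (j - 1) (D (j - 1) (As (j - 1) y)) + D j (As j (A j y)) - idop (H (g j)) y)
      \<in> Linf (g j) (g j)"
    by (simp add: cong_smoothing_def)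
qed

lemma complex_parametrix_imp_fredholm_complex:
  assumes B: "complex_parametrix H L0 Linf g A B"
  shows "fredholm_complex H g A"
  unfolding fredholm_complex_def
proof
  fix j
  have BL0: "B j \<in> L0 (g (j + 1)) (g j)" for j
    using B by (simp add: complex_parametrix_def)
  have B_prev: "B (j - 1) \<in> L0 (g j) (g (j - 1))" using BL0[of "j - 1"] by simp
  let ?K = "\<lambda>y. A (j - 1) (B (j - 1) y) + B j (A j y) - idop (H (g j)) y"
  have K: "?K \<in> Linf (g j) (g j)" using B by (simp add: complex_parametrix_def)
  show "\<exists>F. finite F \<and> {y\<in>H (g j). A j y = 0} \<subseteq> span (F \<union> A (j - 1) ` H (g (j - 1)))"
    by (rule homotopy_imp_finite_cohomology[OF H L0_bop[OF A_prev_L0] L0_bop[OF A_L0]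
          L0_bop[OF B_prev] L0_bop[OF BL0] A_A_prev L0_bop[OF Linf_L0[OF K]] Linf_compact[OF K]])
      (simp add: idop_def)
qed

lemma fredholm_complex_imp_fredholm_Lap:
  assumes "fredholm_complex H g A"
  shows "fredholm_op (H (g j)) (H (g j)) (Lap j)"
proof -
  obtain F where F: "\<And>j. finite (F j)"
    "\<And>j. {y\<in>H (g j). A j y = 0} \<subseteq> span (F j \<union> A (j - 1) ` H (g (j - 1)))"
    using assms unfolding fredholm_complex_def by metis
  \<comment> \<open>Closedness of the range of \<open>A j\<close> is read off from the cohomology
    one place further, at \<open>j + 1\<close>.\<close>
  have "closed (A (j + 1 - 1) ` H (g (j + 1 - 1)))"
    by (rule short_complex.finite_cohomology_imp_closed_range[OF short_complex_Lap F])
  then have "closed (A j ` H (g j))" by simp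
  then show ?thesis
    using short_complex.finite_cohomology_imp_fredholm_lap[OF short_complex_Lap F] lap_eq_Lap by simp
qed

text \<open>If \<open>Q\<close> is a parametrix of the Laplacian, then \<open>Q \<Delta> \<pi> = 0\<close> shows that
  \<open>\<pi> = - (Q \<Delta> - 1) \<pi>\<close> is smoothing.\<close>
lemma kernel_projection_smoothing:
  assumes par: "has_parametrix H L0 Linf (g j) (g j) (Lap j)"
    and p: "is_orth_proj (H (g j)) {x\<in>H (g j). Lap j x = 0} p" and pL0: "p \<in> L0 (g j) (g j)"
  shows "p \<in> Linf (g j) (g j)"
proof -
  obtain Q where Q: "Q \<in> L0 (g j) (g j)"
    "cong_smoothing (g j) (g j) (\<lambda>y. Q (Lap j y)) (idop (H (g j)))"
    using par unfolding has_parametrix_iff by blast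
  have Lp: "Lap j (p y) = 0" for y
    using p by (cases "y \<in> H (g j)") (auto simp: is_orth_proj_def L0_apply_zero[OF Lap_L0])
  have "cong_smoothing (g j) (g j) (\<lambda>y. Q (Lap j (p y))) (\<lambda>y. idop (H (g j)) (p y))"
    by (rule cong_smoothing_comp_right[OF Q(2) pL0])
  then have "cong_smoothing (g j) (g j) p (\<lambda>y. 0)"
    by (simp add: Lp L0_apply_zero[OF Q(1)] idop_L0_apply[OF pL0] cong_smoothing_sym)
  then show ?thesis by (simp add: cong_smoothing_def)
qed

text \<open>The range of \<open>As (j + 1)\<close> is orthogonal to the kernel of \<open>\<Delta>\<close>, so \<open>x = D (As (j + 1) y)\<close> solves
  \<open>\<Delta> x = As (j + 1) y\<close>; applying \<open>As j\<close> gives \<open>As j (A j (As j x)) = 0\<close>, hence \<open>As j x = 0\<close>.\<close>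
lemma As_green_As:
  assumes D: "D \<in> L0 (g (j + 1)) (g (j + 1))"
    and p: "is_orth_proj (H (g (j + 1))) {x\<in>H (g (j + 1)). Lap (j + 1) x = 0} p"
    and LD: "\<And>y. Lap (j + 1) (D y) = idop (H (g (j + 1))) y - p y"
  shows "As j (D (As (j + 1) y)) = 0"
proof (cases "y \<in> H (g (j + 1 + 1))")
  case True
  define v where "v = As (j + 1) y"
  have v: "v \<in> H (g (j + 1))" unfolding v_def by (rule L0_mem[OF As_L0])
  have pv: "p v \<in> H (g (j + 1))" "Lap (j + 1) (p v) = 0" "inner (v - p v) (p v) = 0"
    using p v by (auto simp: is_orth_proj_def)
  then have "A (j + 1) (p v) = 0" by (simp add: Lap_eq_0_iff)
  then have "inner v (p v) = 0" using As_adj[OF pv(1) True] by (simp add: v_def inner_commute)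
  then have "p v = 0" using pv(3) by (simp add: inner_diff_left)
  define x where "x = D v"
  have x: "x \<in> H (g (j + 1))" unfolding x_def by (rule L0_mem[OF D])
  have "Lap (j + 1) x = v" using LD[of v] v \<open>p v = 0\<close> by (simp add: x_def idop_def)
  then have "As j (Lap (j + 1) x) = 0" by (simp add: v_def As_As)
  moreover have "As j (Lap (j + 1) x) = As j (A j (As j x)) + As j (As (j + 1) (A (j + 1) x))"
    using L0_apply_add[OF As_L0 L0_mem[OF A_L0] L0_mem[OF As_L0]] by (simp add: Lap_eq)
  ultimately have 0: "As j (A j (As j x)) = 0" by (simp add: As_As)
  have AsH: "As j x \<in> H (g j)" by (rule L0_mem[OF As_L0])
  \<comment> \<open>Positivity is used twice: pairing the vanishing element with
    \<open>As j x\<close> gives \<open>A j (As j x) = 0\<close>, and pairing this with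
    \<open>x\<close> gives \<open>As j x = 0\<close>.\<close>
  have "inner (A j (As j x)) (A j (As j x)) = 0"
    using As_adj[OF AsH L0_mem[OF A_L0, of j "As j x"]] 0 by simp
  then have "inner (As j x) (As j x) = 0" using As_adj[OF AsH x] by simp
  then show ?thesis by (simp add: x_def v_def)
next
  case False
  then have "As (j + 1) y = 0" using bop_outside[OF L0_bop[OF As_L0]] by blast
  then show ?thesis by (simp add: L0_apply_zero[OF As_L0] L0_apply_zero[OF D])
qed

lemma ext_fredholm_imp_parametrix_complex:
  assumes ext_fredholm: "ext_fredholm_property H L0 Linf"
    and par: "\<And>j. has_parametrix H L0 Linf (g j) (g j) (Lap j)"
  shows "\<exists>B. complex_parametrix H L0 Linf g A B \<and> (\<forall>j. B j \<circ> B (j + 1) = (\<lambda>_. 0))"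
proof -
  have "fredholm_op (H (g j)) (H (g j)) (Lap j)" for j
    using ext_fredholm par Lap_L0 by (simp add: ext_fredholm_property_def fredholm_property_def)
  then have ex: "\<exists>B\<in>L0 (g j) (g j). \<exists>\<pi>. is_orth_proj (H (g j)) {x\<in>H (g j). Lap j x = 0} \<pi> \<and>
      Lap j \<circ> B = (\<lambda>y. idop (H (g j)) y - \<pi> y) \<and> B \<circ> Lap j = (\<lambda>y. idop (H (g j)) y - \<pi> y)" for j
    using ext_fredholm Lap_L0[of j] Lap_selfadjoint[of j] by (simp add: ext_fredholm_property_def)
  \<comment> \<open>Bundles the two witnesses with their properties so that the inverses and the
    projections are chosen together for all positions.\<close>
  define R where "R j B \<pi> \<longleftrightarrow> B \<in> L0 (g j) (g j) \<and>
      is_orth_proj (H (g j)) {x\<in>H (g j). Lap j x = 0} \<pi> \<and>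
      Lap j \<circ> B = (\<lambda>y. idop (H (g j)) y - \<pi> y) \<and> B \<circ> Lap j = (\<lambda>y. idop (H (g j)) y - \<pi> y)"
    for j B \<pi>
  have "\<forall>j. \<exists>B \<pi>. R j B \<pi>" using ex unfolding R_def Bex_def by simp
  then obtain D p where R: "\<And>j. R j (D j) (p j)" by metis
  have D: "D j \<in> L0 (g j) (g j)"
    and p: "is_orth_proj (H (g j)) {x\<in>H (g j). Lap j x = 0} (p j)"
    and LD: "Lap j \<circ> D j = (\<lambda>y. idop (H (g j)) y - p j y)"
    and DL: "D j \<circ> Lap j = (\<lambda>y. idop (H (g j)) y - p j y)" for j
    using R[of j] by (simp_all add: R_def)
  have LD': "Lap j (D j y) = idop (H (g j)) y - p j y"
    and DL': "D j (Lap j y) = idop (H (g j)) y - p j y" for j y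
    using fun_cong[OF LD, of j y] fun_cong[OF DL, of j y] by simp_all
  \<comment> \<open>The extended Fredholm property gives the projection only as a map; it belongs to
    the algebra because it equals the identity minus \<open>Lap j\<close> composed with
    \<open>D j\<close>.\<close>
  have pL0: "p j \<in> L0 (g j) (g j)" for j
    using L0_diff[OF idop_L0 L0_comp[OF D Lap_L0], of j] by (simp add: LD')
  have "p j \<in> Linf (g j) (g j)" for j by (rule kernel_projection_smoothing[OF par p pL0])
  then have neg: "(\<lambda>y. - p j y) \<in> Linf (g j) (g j)" for j
    using Linf_scaleR[of "p j" "g j" "g j" "-1"] by simp
  have "complex_parametrix H L0 Linf g A (\<lambda>j y. D j (As j y))"
    by (rule complex_parametrix_of_Lap[OF D]) (simp_all add: cong_smoothing_def LD' DL' neg)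
  moreover have "(\<lambda>y. D j (As j y)) \<circ> (\<lambda>y. D (j + 1) (As (j + 1) y)) = (\<lambda>_. 0)" for j
    by (rule ext) (simp add: As_green_As[OF D p LD'] L0_apply_zero[OF D])
  ultimately show ?thesis by (intro exI[of _ "\<lambda>j y. D j (As j y)"]) simp
qed

end

subsection \<open>Principal symbols\<close>

locale classical_complex = alg_complex H L0 Linf g A
  for H :: "'g \<Rightarrow> 'h::{real_inner,complete_space} set"
    and L0 Linf :: "'g \<Rightarrow> 'g \<Rightarrow> ('h \<Rightarrow> 'h) set"
    and g :: "int \<Rightarrow> 'g" and A :: "int \<Rightarrow> 'h \<Rightarrow> 'h" +
  fixes n :: nat and X :: "nat \<Rightarrow> 'x set"
    and E :: "nat \<Rightarrow> 'g \<Rightarrow> 'x \<Rightarrow> 'e::{real_inner,complete_space} set"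
    and \<sigma> :: "nat \<Rightarrow> 'g \<Rightarrow> 'g \<Rightarrow> ('h \<Rightarrow> 'h) \<Rightarrow> 'x \<Rightarrow> ('e \<Rightarrow> 'e)"
  assumes cl: "cl_gen_op_alg H L0 Linf n X E \<sigma>"
begin

lemma
  assumes lx: "l < n" "x \<in> X l"
  shows E: "hilbert_sub (E l g0 x)"
    and \<sigma>_bop: "P \<in> L0 g0 g1 \<Longrightarrow> bop (E l g0 x) (E l g1 x) (\<sigma> l g0 g1 P x)"
    and \<sigma>_add: "P \<in> L0 g0 g1 \<Longrightarrow> Q \<in> L0 g0 g1 \<Longrightarrow>
      \<sigma> l g0 g1 (\<lambda>y. P y + Q y) x u = \<sigma> l g0 g1 P x u + \<sigma> l g0 g1 Q x u"
    and \<sigma>_comp: "P \<in> L0 g0 g1 \<Longrightarrow> Q \<in> L0 g1 g2 \<Longrightarrow>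
      \<sigma> l g0 g2 (\<lambda>y. Q (P y)) x u = \<sigma> l g1 g2 Q x (\<sigma> l g0 g1 P x u)"
    and \<sigma>_adj: "P \<in> L0 g0 g1 \<Longrightarrow> Q \<in> L0 g1 g0 \<Longrightarrow> is_adj (H g0) (H g1) P Q \<Longrightarrow>
      is_adj (E l g0 x) (E l g1 x) (\<sigma> l g0 g1 P x) (\<sigma> l g1 g0 Q x)"
    and \<sigma>_smoothing: "P \<in> Linf g0 g1 \<Longrightarrow> \<sigma> l g0 g1 P x = (\<lambda>_. 0)"
proof -
  have 1: "\<forall>l<n. \<forall>g. \<forall>x\<in>X l. hilbert_sub (E l g x)"
    and 2: "\<forall>l<n. \<forall>g0 g1. \<forall>A\<in>L0 g0 g1. \<forall>x\<in>X l. bop (E l g0 x) (E l g1 x) (\<sigma> l g0 g1 A x)"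
    and 3: "\<forall>l<n. \<forall>g0 g1. \<forall>A\<in>L0 g0 g1. \<forall>B\<in>L0 g0 g1. \<forall>x\<in>X l.
      \<sigma> l g0 g1 (\<lambda>y. A y + B y) x = (\<lambda>u. \<sigma> l g0 g1 A x u + \<sigma> l g0 g1 B x u)"
    and 4: "\<forall>l<n. \<forall>g0 g1 g2. \<forall>A\<in>L0 g0 g1. \<forall>B\<in>L0 g1 g2. \<forall>x\<in>X l.
      \<sigma> l g0 g2 (B \<circ> A) x = \<sigma> l g1 g2 B x \<circ> \<sigma> l g0 g1 A x"
    and 5: "\<forall>l<n. \<forall>g0 g1. \<forall>A\<in>L0 g0 g1. \<forall>A'\<in>L0 g1 g0. \<forall>x\<in>X l. is_adj (H g0) (H g1) A A' \<longrightarrow>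
      is_adj (E l g0 x) (E l g1 x) (\<sigma> l g0 g1 A x) (\<sigma> l g1 g0 A' x)"
    and 6: "\<forall>l<n. \<forall>g0 g1. \<forall>A\<in>Linf g0 g1. \<forall>x\<in>X l. \<sigma> l g0 g1 A x = (\<lambda>_. 0)"
    using cl unfolding cl_gen_op_alg_def by - (elim conjE, assumption)+
  show "hilbert_sub (E l g0 x)"
    by (rule 1[rule_format, OF lx])
  show "P \<in> L0 g0 g1 \<Longrightarrow> bop (E l g0 x) (E l g1 x) (\<sigma> l g0 g1 P x)"
    by (rule 2[rule_format, OF lx(1) _ lx(2)])
  show "P \<in> L0 g0 g1 \<Longrightarrow> Q \<in> L0 g0 g1 \<Longrightarrow>
      \<sigma> l g0 g1 (\<lambda>y. P y + Q y) x u = \<sigma> l g0 g1 P x u + \<sigma> l g0 g1 Q x u"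
    by (rule fun_cong[OF 3[rule_format, OF lx(1) _ _ lx(2)]])
  show "P \<in> L0 g0 g1 \<Longrightarrow> Q \<in> L0 g1 g2 \<Longrightarrow>
      \<sigma> l g0 g2 (\<lambda>y. Q (P y)) x u = \<sigma> l g1 g2 Q x (\<sigma> l g0 g1 P x u)"
    using 4[rule_format, OF lx(1) _ _ lx(2), of P g0 g1 Q g2] by (simp add: comp_def)
  show "P \<in> L0 g0 g1 \<Longrightarrow> Q \<in> L0 g1 g0 \<Longrightarrow> is_adj (H g0) (H g1) P Q \<Longrightarrow>
      is_adj (E l g0 x) (E l g1 x) (\<sigma> l g0 g1 P x) (\<sigma> l g1 g0 Q x)"
    by (rule 5[rule_format, OF lx(1) _ _ lx(2)])
  show "P \<in> Linf g0 g1 \<Longrightarrow> \<sigma> l g0 g1 P x = (\<lambda>_. 0)"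
    by (rule 6[rule_format, OF lx(1) _ lx(2)])
qed

lemma sym_elliptic_iff_parametrix:
  assumes "P \<in> L0 g0 g1"
  shows "sym_elliptic n X E \<sigma> g0 g1 P \<longleftrightarrow> has_parametrix H L0 Linf g0 g1 P"
  using cl assms by (simp add: cl_gen_op_alg_def)

abbreviation sA :: "nat \<Rightarrow> 'x \<Rightarrow> int \<Rightarrow> 'e \<Rightarrow> 'e" where
  "sA l x j \<equiv> \<sigma> l (g j) (g (j + 1)) (A j) x"

text \<open>Kept apart from \<open>sA l x (j - 1)\<close>, whose target weight would read
  \<open>g (j - 1 + 1)\<close> instead of \<open>g j\<close>.\<close>

abbreviation sA_prev :: "nat \<Rightarrow> 'x \<Rightarrow> int \<Rightarrow> 'e \<Rightarrow> 'e" where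
  "sA_prev l x j \<equiv> \<sigma> l (g (j - 1)) (g j) (A (j - 1)) x"

abbreviation sAs :: "nat \<Rightarrow> 'x \<Rightarrow> int \<Rightarrow> 'e \<Rightarrow> 'e" where
  "sAs l x j \<equiv> \<sigma> l (g (j + 1)) (g j) (As j) x"

abbreviation sAs_prev :: "nat \<Rightarrow> 'x \<Rightarrow> int \<Rightarrow> 'e \<Rightarrow> 'e" where
  "sAs_prev l x j \<equiv> \<sigma> l (g j) (g (j - 1)) (As (j - 1)) x"

lemma short_complex_symbol:
  assumes lx: "l < n" "x \<in> X l"
  shows "short_complex (E l (g (j - 1)) x) (E l (g j) x) (E l (g (j + 1)) x)
    (sA_prev l x j) (sA l x j) (sAs_prev l x j) (sAs l x j)"
proof
  show "is_adj (E l (g (j - 1)) x) (E l (g j) x) (sA_prev l x j) (sAs_prev l x j)"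
    using short_complex.adja[OF short_complex_Lap] by (rule \<sigma>_adj[OF lx A_prev_L0 As_prev_L0])
  show "is_adj (E l (g j) x) (E l (g (j + 1)) x) (sA l x j) (sAs l x j)"
    by (rule \<sigma>_adj[OF lx A_L0 As_L0 As_is_adj])
  \<comment> \<open>The composition is the zero operator, which is smoothing and hence has zero
    symbol.\<close>
  show "sA l x j (sA_prev l x j u) = 0" for u
    using \<sigma>_comp[OF lx A_prev_L0 A_L0, of j u] \<sigma>_smoothing[OF lx zero_Linf]
    by (simp add: A_A_prev)
qed (rule E[OF lx] \<sigma>_bop[OF lx A_prev_L0] \<sigma>_bop[OF lx A_L0] \<sigma>_bop[OF lx As_prev_L0]
    \<sigma>_bop[OF lx As_L0])+

lemma lap_eq_symbol_Lap:
  assumes lx: "l < n" "x \<in> X l"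
  shows "short_complex.lap (sA_prev l x j) (sA l x j) (sAs_prev l x j) (sAs l x j) =
    \<sigma> l (g j) (g j) (Lap j) x"
proof
  fix u
  have "\<sigma> l (g j) (g j) (Lap j) x u =
      \<sigma> l (g j) (g j) (\<lambda>y. A (j - 1) (As (j - 1) y)) x u + \<sigma> l (g j) (g j) (\<lambda>y. As j (A j y)) x u"
    unfolding Lap_eq[abs_def]
    by (rule \<sigma>_add[OF lx L0_comp[OF As_prev_L0 A_prev_L0] L0_comp[OF A_L0 As_L0]])
  also have "\<dots> = sA_prev l x j (sAs_prev l x j u) + sAs l x j (sA l x j u)"
    by (simp only: \<sigma>_comp[OF lx As_prev_L0 A_prev_L0] \<sigma>_comp[OF lx A_L0 As_L0])
  finally show "short_complex.lap (sA_prev l x j) (sA l x j) (sAs_prev l x j) (sAs l x j) u =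
      \<sigma> l (g j) (g j) (Lap j) x u"
    by (simp add: short_complex.lap_def[OF short_complex_symbol[OF lx]])
qed

lemma elliptic_complex_iff_Lap:
  "elliptic_complex n X E \<sigma> g A \<longleftrightarrow> (\<forall>j. sym_elliptic n X E \<sigma> (g j) (g j) (Lap j))"
proof
  assume ell: "elliptic_complex n X E \<sigma> g A"
  show "\<forall>j. sym_elliptic n X E \<sigma> (g j) (g j) (Lap j)"
    unfolding sym_elliptic_def
  proof (intro allI impI ballI)
    fix j l x assume lx: "l < n" "x \<in> X l"
    have exact: "{u\<in>E l (g j) x. sA l x j u = 0} = sA_prev l x j ` E l (g (j - 1)) x" for j
      using ell lx by (simp add: elliptic_complex_def)
    \<comment> \<open>By exactness at \<open>j + 1\<close> this kernel is the image of the symbol of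
      \<open>A j\<close>, whose closedness is needed at position \<open>j\<close>.\<close>
    have "closed {u\<in>E l (g (j + 1)) x. sA l x (j + 1) u = 0}"
      by (rule conjunct2[OF hilbert_sub_kernel[OF \<sigma>_bop[OF lx A_L0] E[OF lx],
            unfolded hilbert_sub_def]])
    then have "closed (sA l x j ` E l (g j) x)" using exact[of "j + 1"] by (simp only: add_diff_cancel_right')
    then show "bij_betw (\<sigma> l (g j) (g j) (Lap j) x) (E l (g j) x) (E l (g j) x)"
      using short_complex.exact_imp_bij_lap[OF short_complex_symbol[OF lx] exact]
        lap_eq_symbol_Lap[OF lx] by simp
  qed
next
  assume ell: "\<forall>j. sym_elliptic n X E \<sigma> (g j) (g j) (Lap j)"
  show "elliptic_complex n X E \<sigma> g A"
    unfolding elliptic_complex_def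
  proof (intro allI impI ballI)
    fix l x j assume lx: "l < n" "x \<in> X l"
    have "bij_betw (\<sigma> l (g j) (g j) (Lap j) x) (E l (g j) x) (E l (g j) x)"
      using ell lx by (simp add: sym_elliptic_def)
    then show "{u\<in>E l (g j) x. sA l x j u = 0} = sA_prev l x j ` E l (g (j - 1)) x"
      using short_complex.bij_lap_imp_exact[OF short_complex_symbol[OF lx]]
        lap_eq_symbol_Lap[OF lx] by simp
  qed
qed

text \<open>Removes the symbols from ellipticity, so that it can be compared with the Fredholm
  property, which speaks of parametrices only.\<close>

lemma elliptic_complex_iff_Lap_parametrix:
  "elliptic_complex n X E \<sigma> g A \<longleftrightarrow> (\<forall>j. has_parametrix H L0 Linf (g j) (g j) (Lap j))"
  by (simp add: elliptic_complex_iff_Lap sym_elliptic_iff_parametrix[OF Lap_L0])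

lemma elliptic_imp_complex_parametrix:
  assumes "elliptic_complex n X E \<sigma> g A"
  shows "\<exists>B. complex_parametrix H L0 Linf g A B"
proof -
  have "\<forall>j. \<exists>D\<in>L0 (g j) (g j). cong_smoothing (g j) (g j) (\<lambda>y. Lap j (D y)) (idop (H (g j))) \<and>
      cong_smoothing (g j) (g j) (\<lambda>y. D (Lap j y)) (idop (H (g j)))"
    using assms unfolding elliptic_complex_iff_Lap_parametrix has_parametrix_iff .
  then obtain D where "\<And>j. D j \<in> L0 (g j) (g j)"
    "\<And>j. cong_smoothing (g j) (g j) (\<lambda>y. Lap j (D j y)) (idop (H (g j)))"
    "\<And>j. cong_smoothing (g j) (g j) (\<lambda>y. D j (Lap j y)) (idop (H (g j)))"
    by metis
  then show ?thesis using complex_parametrix_of_Lap by blast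
qed

lemma fredholm_complex_imp_elliptic:
  assumes "fredholm_property H L0 Linf" "fredholm_complex H g A"
  shows "elliptic_complex n X E \<sigma> g A"
  using assms fredholm_complex_imp_fredholm_Lap[OF assms(2)] Lap_L0
  by (simp add: elliptic_complex_iff_Lap_parametrix fredholm_property_def)

end

theorem mainTheorem11:
  fixes H :: "'g \<Rightarrow> 'h::{real_inner,complete_space} set"
    and L0 Linf :: "'g \<Rightarrow> 'g \<Rightarrow> ('h \<Rightarrow> 'h) set"
    and n :: nat and X :: "nat \<Rightarrow> 'x set"
    and E :: "nat \<Rightarrow> 'g \<Rightarrow> 'x \<Rightarrow> 'e::{real_inner,complete_space} set"
    and \<sigma> :: "nat \<Rightarrow> 'g \<Rightarrow> 'g \<Rightarrow> ('h \<Rightarrow> 'h) \<Rightarrow> 'x \<Rightarrow> ('e \<Rightarrow> 'e)"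
    and g :: "int \<Rightarrow> 'g" and A :: "int \<Rightarrow> 'h \<Rightarrow> 'h"
  assumes alg: "cl_gen_op_alg H L0 Linf n X E \<sigma>"
    and cx: "op_complex L0 g A"
  shows "(elliptic_complex n X E \<sigma> g A \<longleftrightarrow>
            (\<forall>j. sym_elliptic n X E \<sigma> (g j) (g j) (laplacian H L0 g A j)))
       \<and> (elliptic_complex n X E \<sigma> g A \<longrightarrow> (\<exists>B. complex_parametrix H L0 Linf g A B))
       \<and> (elliptic_complex n X E \<sigma> g A \<longrightarrow> fredholm_complex H g A)
       \<and> (fredholm_property H L0 Linf \<longrightarrow>
            ((\<exists>B. complex_parametrix H L0 Linf g A B) \<longleftrightarrow> elliptic_complex n X E \<sigma> g A)
          \<and> (fredholm_complex H g A \<longleftrightarrow> elliptic_complex n X E \<sigma> g A))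
       \<and> (ext_fredholm_property H L0 Linf \<longrightarrow> (\<exists>B. complex_parametrix H L0 Linf g A B) \<longrightarrow>
            (\<exists>B. complex_parametrix H L0 Linf g A B \<and> (\<forall>j. B j \<circ> B (j + 1) = (\<lambda>_. 0))))"
proof -
  interpret classical_complex H L0 Linf g A n X E \<sigma>
    by unfold_locales (use alg cx in \<open>simp_all add: cl_gen_op_alg_def\<close>)
  let ?ell = "elliptic_complex n X E \<sigma> g A"
  let ?par = "\<exists>B. complex_parametrix H L0 Linf g A B"
  have ab: "?ell \<longleftrightarrow> (\<forall>j. sym_elliptic n X E \<sigma> (g j) (g j) (Lap j))"
    by (rule elliptic_complex_iff_Lap)
  have ac: "?ell \<Longrightarrow> ?par" by (rule elliptic_imp_complex_parametrix)
  have cd: "?par \<Longrightarrow> fredholm_complex H g A" using complex_parametrix_imp_fredholm_complex by blast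
  have da: "fredholm_property H L0 Linf \<Longrightarrow> fredholm_complex H g A \<Longrightarrow> ?ell"
    by (rule fredholm_complex_imp_elliptic)
  have ext: "\<exists>B. complex_parametrix H L0 Linf g A B \<and> (\<forall>j. B j \<circ> B (j + 1) = (\<lambda>_. 0))"
    if "ext_fredholm_property H L0 Linf" ?par
  proof (rule ext_fredholm_imp_parametrix_complex[OF that(1)])
    \<comment> \<open>The parametrix of the complex says nothing directly about the Laplacians;
      finite cohomology and the Fredholm property contained in the extended one lead back to
      ellipticity.\<close>
    have "?ell" using that cd da by (simp add: ext_fredholm_property_def)
    then show "has_parametrix H L0 Linf (g j) (g j) (Lap j)" for j
      by (simp add: elliptic_complex_iff_Lap_parametrix)
  qed
  show ?thesis using ab ac cd da ext by blast
qed

end
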